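(* Let $\beta_c=\frac{4\ln 2}{n}$. There is a constant $c_1>0$ such that for any sequence of inverse temperatures $\beta_c=\beta_M\ge\beta_{M-1}\ge\cdots\ge\beta_0\ge 0$ with $M=n^{O(1)}$, the simulated tempering chain and the swapping chain with the distributions $\pi_{\beta_0},\dots,\pi_{\beta_M}$ for the $3$-state mean-field ferromagnetic Potts model have mixing time $\tau(\varepsilon)\ge e^{c_1 n}\ln(1/\varepsilon)$.
   Context: 3-state mean-field Potts model: $V=\{1,\dots,n\}$ (complete graph), configurations $x\in\Omega=\{1,2,3\}^V$, $H(x)=\sum_{i<j}\delta_{x_i,x_j}$, Gibbs distribution $\pi_\beta(x)=e^{\beta H(x)}/Z(\beta)$ (no external field). For a distribution $\rho$ on $\Omega$, the Metropolis chain $M_\rho$ proposes from $x$ the configuration $y$ obtained by setting a uniformly random vertex to a uniformly random spin, accepted with probability $\min(1,\rho(y)/\rho(x))$. Simulated tempering chain with distributions $\pi_0,\dots,\pi_M$ (here $\pi_i=\pi_{\beta_i}$): state space $\Omega\times\{0,\dots,M\}$. With probability $1/2$ it makes a level move: from $(x,i)$ to $(x',i)$ with probability $\frac12 M_{\pi_i}(x,x')$. Otherwise it makes a temperature move: from $(x,i)$ choose $j=i\pm1$ (with probability $1/2$ each, and from $0$ or $M$ the single neighbor is chosen with probability $1/2$, the chain otherwise staying put) and move to $(x,j)$ with probability $\min(1,\pi_j(x)/\pi_i(x))$. Its stationary distribution is $\pi_{st}(x,i)=\pi_i(x)/(M+1)$. Swapping chain: state space $\Omega^{M+1}$, stationary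 distribution $\prod_i\pi_i(x_i)$; each step chooses uniformly between a level move (choose $i\in\{0,\dots,M\}$ uniformly and update $x_i$ by one step of $M_{\pi_i}$, i.e. probability $\frac{1}{2(M+1)}M_{\pi_i}(x_i,x_i')$) and a swap move (choose $i\in\{0,\dots,M-1\}$ uniformly and exchange coordinates $i,i+1$ with probability $\frac1{2M}\min\big(1,\frac{\pi_{i+1}(x_i)\pi_i(x_{i+1})}{\pi_i(x_i)\pi_{i+1}(x_{i+1})}\big)$). Mixing time: $\tau(\varepsilon)=\min\{t:\max_x\frac12\sum_y|P^{t'}(x,y)-\pi(y)|\le\varepsilon\ \forall t'\ge t\}$.
   Formalization: The bound is proved for all sufficiently large n and for 0 < ε ≤ 1/2; as stated it fails for ε close to 1, where τ(ε) = 0 but ln(1/ε) > 0, and for small n (n = 1, M = 0, ε = 1/3). *)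

theory Defs
  imports "HOL-Probability.Probability" "HOL-Library.Landau_Symbols"
begin

section \<open>Finite Markov chains\<close>

text \<open>A chain is given by its kernel \<open>K\<close>: one step from \<open>x\<close> is distributed according to \<open>K x\<close>.\<close>

primrec chain_pow :: "('a \<Rightarrow> 'a pmf) \<Rightarrow> nat \<Rightarrow> 'a \<Rightarrow> 'a pmf" where
  "chain_pow K 0 x = return_pmf x"
| "chain_pow K (Suc t) x = bind_pmf (K x) (chain_pow K t)"

definition distance_to_stationarity ::
  "'a set \<Rightarrow> ('a \<Rightarrow> 'a pmf) \<Rightarrow> ('a \<Rightarrow> real) \<Rightarrow> nat \<Rightarrow> real" where
  "distance_to_stationarity S K \<pi> t =
     (MAX x\<in>S. 1 / 2 * (\<Sum>y\<in>S. \<bar>pmf (chain_pow K t x) y - \<pi> y\<bar>))"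

text \<open>Valued in \<^typ>\<open>enat\<close>, so that the minimum over an empty set of times would be \<open>\<infinity>\<close>.\<close>

definition mixing_time ::
  "'a set \<Rightarrow> ('a \<Rightarrow> 'a pmf) \<Rightarrow> ('a \<Rightarrow> real) \<Rightarrow> real \<Rightarrow> enat" where
  "mixing_time S K \<pi> \<epsilon> =
     Inf (enat ` {t. \<forall>t'\<ge>t. distance_to_stationarity S K \<pi> t' \<le> \<epsilon>})"

section \<open>The 3-state mean-field Potts model\<close>

type_synonym config = "nat \<Rightarrow> nat"

definition configs :: "nat \<Rightarrow> config set" where
  "configs n = {1..n} \<rightarrow>\<^sub>E {1, 2, 3}"

definition hamiltonian :: "nat \<Rightarrow> config \<Rightarrow> real" where
  "hamiltonian n x = (\<Sum>i\<in>{1..n}. \<Sum>j\<in>{i<..n}. of_bool (x i = x j))"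

definition partition_function :: "nat \<Rightarrow> real \<Rightarrow> real" where
  "partition_function n \<beta> = (\<Sum>x\<in>configs n. exp (\<beta> * hamiltonian n x))"

definition gibbs :: "nat \<Rightarrow> real \<Rightarrow> config \<Rightarrow> real" where
  "gibbs n \<beta> x = exp (\<beta> * hamiltonian n x) / partition_function n \<beta>"

section \<open>The Metropolis, simulated tempering and swapping chains\<close>

text \<open>The uniform choice of a vertex is meaningful only for \<open>n \<ge> 1\<close>.\<close>

definition metropolis :: "nat \<Rightarrow> (config \<Rightarrow> real) \<Rightarrow> config \<Rightarrow> config pmf" where
  "metropolis n \<rho> x =
     do {
       v \<leftarrow> pmf_of_set {1..n};
       s \<leftarrow> pmf_of_set {1, 2, 3};
       let y = x(v := s);
       accept \<leftarrow> bernoulli_pmf (min 1 (\<rho> y / \<rho> x));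
       return_pmf (if accept then y else x)
     }"

text \<open>In both chains below, the first coin decides between a level move and a temperature
  (resp. swap) move, and accounts for the factor \<open>1/2\<close> in their transition probabilities.\<close>

definition tempering_space :: "nat \<Rightarrow> nat \<Rightarrow> (config \<times> nat) set" where
  "tempering_space n M = configs n \<times> {0..M}"

definition tempering_chain ::
  "nat \<Rightarrow> nat \<Rightarrow> (nat \<Rightarrow> config \<Rightarrow> real) \<Rightarrow> config \<times> nat \<Rightarrow> (config \<times> nat) pmf" where
  "tempering_chain n M \<rho> = (\<lambda>(x, i).
     do {
       level \<leftarrow> bernoulli_pmf (1 / 2);
       if level then map_pmf (\<lambda>x'. (x', i)) (metropolis n (\<rho> i) x)
       else do {
         up \<leftarrow> bernoulli_pmf (1 / 2);
         if (up \<and> i = M) \<or> (\<not> up \<and> i = 0) then return_pmf (x, i)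
         else do {
           let j = (if up then i + 1 else i - 1);
           accept \<leftarrow> bernoulli_pmf (min 1 (\<rho> j x / \<rho> i x));
           return_pmf (x, if accept then j else i)
         }
       }
     })"

definition tempering_stationary ::
  "nat \<Rightarrow> (nat \<Rightarrow> config \<Rightarrow> real) \<Rightarrow> config \<times> nat \<Rightarrow> real" where
  "tempering_stationary M \<rho> = (\<lambda>(x, i). \<rho> i x / (real M + 1))"

definition swapping_space :: "nat \<Rightarrow> nat \<Rightarrow> (nat \<Rightarrow> config) set" where
  "swapping_space n M = {0..M} \<rightarrow>\<^sub>E configs n"

text \<open>For \<open>M = 0\<close> there is no pair of coordinates to exchange, and a swap move does nothing.\<close>

definition swapping_chain ::
  "nat \<Rightarrow> nat \<Rightarrow> (nat \<Rightarrow> config \<Rightarrow> real) \<Rightarrow> (nat \<Rightarrow> config) \<Rightarrow> (nat \<Rightarrow> config) pmf" where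
  "swapping_chain n M \<rho> x =
     do {
       level \<leftarrow> bernoulli_pmf (1 / 2);
       if level then do {
         i \<leftarrow> pmf_of_set {0..M};
         map_pmf (\<lambda>x'. x(i := x')) (metropolis n (\<rho> i) (x i))
       }
       else if M = 0 then return_pmf x
       else do {
         i \<leftarrow> pmf_of_set {0..<M};
         accept \<leftarrow> bernoulli_pmf
           (min 1 (\<rho> (i + 1) (x i) * \<rho> i (x (i + 1)) / (\<rho> i (x i) * \<rho> (i + 1) (x (i + 1)))));
         return_pmf (if accept then x(i := x (i + 1), i + 1 := x i) else x)
       }
     }"

definition swapping_stationary ::
  "nat \<Rightarrow> (nat \<Rightarrow> config \<Rightarrow> real) \<Rightarrow> (nat \<Rightarrow> config) \<Rightarrow> real" where
  "swapping_stationary M \<rho> x = (\<Prod>i\<in>{0..M}. \<rho> i (x i))"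

section \<open>Mixing times of the two chains for the Potts model\<close>

definition tempering_mixing_time :: "nat \<Rightarrow> nat \<Rightarrow> (nat \<Rightarrow> real) \<Rightarrow> real \<Rightarrow> enat" where
  "tempering_mixing_time n M \<beta> \<epsilon> =
     mixing_time (tempering_space n M) (tempering_chain n M (\<lambda>i. gibbs n (\<beta> i)))
       (tempering_stationary M (\<lambda>i. gibbs n (\<beta> i))) \<epsilon>"

definition swapping_mixing_time :: "nat \<Rightarrow> nat \<Rightarrow> (nat \<Rightarrow> real) \<Rightarrow> real \<Rightarrow> enat" where
  "swapping_mixing_time n M \<beta> \<epsilon> =
     mixing_time (swapping_space n M) (swapping_chain n M (\<lambda>i. gibbs n (\<beta> i)))
       (swapping_stationary M (\<lambda>i. gibbs n (\<beta> i))) \<epsilon>"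

definition beta_crit :: "nat \<Rightarrow> real" where
  "beta_crit n = 4 * ln 2 / real n"

end

theory Submission imports Defs begin

text \<open>The idea is a bottleneck that no temperature \<open>\<beta> \<le> \<beta>\<^sub>c\<close> opens. At \<open>\<beta>\<^sub>c\<close> the disordered phase, with
  colour fractions \<open>(1/3, 1/3, 1/3)\<close>, and the three ordered ones, permutations of \<open>(2/3, 1/6, 1/6)\<close>,
  have the same exponential weight, while configurations with a colour fraction close to \<open>1/2\<close>
  are lighter by a factor \<open>exp (- gap \<cdot> n)\<close>, where \<open>gap = ln 3 - 19/12 ln 2 > 0\<close> because
  \<open>2\<^sup>1\<^sup>9 < 3\<^sup>1\<^sup>2\<close>. The disordered phase has the least energy, so relative to it the cut only gets
  lighter when \<open>\<beta>\<close> decreases. Changes of temperature and swaps do not alter the phases present, so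
  a set of states defined by the phases is left only through the cut, whereas the level \<open>\<beta>\<^sub>c\<close> alone
  gives it polynomially large probability.

  For a reversible kernel \<open>P\<close> and \<open>f = 1\<^sub>A - \<pi>(A)\<close>, log-convexity of \<open>s \<mapsto> \<parallel>P\<^sup>s f\<parallel>\<^sup>2\<close> turns a small escape
  rate into a lower bound on the distance to stationarity at all even times; together with
  \<open>\<pi>(A) \<le> 1/3\<close> this gives the factor \<open>ln (1 / \<epsilon>)\<close> up to \<open>\<epsilon> = 1/2\<close>.\<close>

section \<open>Escape rates of finite reversible chains\<close>

text \<open>Nothing forces the spectrum of these kernels to be nonnegative, so powers at odd times
  cannot be bounded from below. Even times suffice, because the mixing time asks for closeness at
  every later time. The value 4 ln 2 / n and the threshold 1/2 belong together. Give one colour the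
  fraction 1/2 + u and split the rest evenly: at this temperature, and with these three colours, the
  rate becomes an even function of u. The disordered phase sits at u = -1/6, an ordered one at u =
  1/6, and the cut at the centre of symmetry u = 0. Coexistence of the phases is thus a reflection,
  and only estimates in one variable remain. Counting colour statistics replaces Stirling's
  formula.\<close>

locale reversible_chain =
  fixes S :: "'a set" and K :: "'a \<Rightarrow> 'a pmf" and \<pi> :: "'a \<Rightarrow> real"
  assumes finite_space: "finite S"
    and kernel_closed: "x \<in> S \<Longrightarrow> set_pmf (K x) \<subseteq> S"
    and pi_nonneg: "x \<in> S \<Longrightarrow> 0 \<le> \<pi> x"
    and pi_sum: "sum \<pi> S = 1"
    and balance: "\<lbrakk>x \<in> S; y \<in> S\<rbrakk> \<Longrightarrow> \<pi> x * pmf (K x) y = \<pi> y * pmf (K y) x"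
begin

section \<open>The transition operator on the weighted L2 space\<close>

definition markov_op :: "('a \<Rightarrow> real) \<Rightarrow> 'a \<Rightarrow> real" where
  "markov_op f x = (\<Sum>y\<in>S. pmf (K x) y * f y)"

definition dot :: "('a \<Rightarrow> real) \<Rightarrow> ('a \<Rightarrow> real) \<Rightarrow> real" where
  "dot f g = (\<Sum>x\<in>S. \<pi> x * f x * g x)"

lemma dot_commute: "dot f g = dot g f"
  by (simp add: dot_def mult_ac)

lemma dot_diff_left: "dot (\<lambda>x. f x - g x) h = dot f h - dot g h"
  by (simp add: dot_def algebra_simps sum_subtractf)

lemma dot_const_left: "dot (\<lambda>x. c) h = c * dot (\<lambda>x. 1) h"
  by (simp add: dot_def sum_distrib_left mult_ac)

lemma dot_self_adjoint: "dot f (markov_op g) = dot (markov_op f) g"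
proof -
  have "dot f (markov_op g) = (\<Sum>x\<in>S. \<Sum>y\<in>S. (\<pi> x * pmf (K x) y) * (f x * g y))"
    by (simp add: dot_def markov_op_def sum_distrib_left mult_ac)
  also have "\<dots> = (\<Sum>x\<in>S. \<Sum>y\<in>S. (\<pi> y * pmf (K y) x) * (f x * g y))"
    by (intro sum.cong refl) (use balance in auto)
  also have "\<dots> = (\<Sum>y\<in>S. \<Sum>x\<in>S. (\<pi> y * pmf (K y) x) * (f x * g y))"
    by (rule sum.swap)
  also have "\<dots> = dot (markov_op f) g"
    by (simp add: dot_def markov_op_def sum_distrib_left sum_distrib_right mult_ac)
  finally show ?thesis .
qed

lemma dot_Cauchy_Schwarz: "(dot f g)\<^sup>2 \<le> dot f f * dot g g"
proof -
  have "(\<Sum>x\<in>S. (sqrt (\<pi> x) * f x) * (sqrt (\<pi> x) * g x))\<^sup>2 \<le>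
      (\<Sum>x\<in>S. (sqrt (\<pi> x) * f x)\<^sup>2) * (\<Sum>x\<in>S. (sqrt (\<pi> x) * g x)\<^sup>2)"
    by (rule Cauchy_Schwarz_ineq_sum)
  moreover have "(\<Sum>x\<in>S. (sqrt (\<pi> x) * f x) * (sqrt (\<pi> x) * g x)) = dot f g"
    unfolding dot_def
  proof (intro sum.cong refl)
    fix x assume "x \<in> S"
    have "(sqrt (\<pi> x) * f x) * (sqrt (\<pi> x) * g x) = (sqrt (\<pi> x) * sqrt (\<pi> x)) * f x * g x"
      by (simp only: mult_ac)
    then show "(sqrt (\<pi> x) * f x) * (sqrt (\<pi> x) * g x) = \<pi> x * f x * g x"
      using pi_nonneg[OF \<open>x \<in> S\<close>] by simp
  qed
  moreover have "(\<Sum>x\<in>S. (sqrt (\<pi> x) * h x)\<^sup>2) = dot h h" for h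
    unfolding dot_def
    by (intro sum.cong refl) (simp add: pi_nonneg power_mult_distrib power2_eq_square)
  ultimately show ?thesis by simp
qed

lemma sum_pmf_kernel: "x \<in> S \<Longrightarrow> (\<Sum>y\<in>S. pmf (K x) y) = 1"
  using finite_space kernel_closed by (intro sum_pmf_eq_1)

lemma dot_one_op: "dot (\<lambda>x. 1) (markov_op f) = dot (\<lambda>x. 1) f"
proof -
  have "dot (markov_op (\<lambda>x. 1)) f = dot (\<lambda>x. 1) f"
    unfolding dot_def markov_op_def by (intro sum.cong refl) (simp add: sum_pmf_kernel)
  then show ?thesis by (simp add: dot_self_adjoint)
qed

lemma dot_one_op_pow: "dot (\<lambda>x. 1) ((markov_op ^^ t) f) = dot (\<lambda>x. 1) f"
  by (induction t) (simp_all add: dot_one_op)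

lemma dot_op_pow: "dot f ((markov_op ^^ (s + t)) f) = dot ((markov_op ^^ s) f) ((markov_op ^^ t) f)"
proof (induction s arbitrary: t)
  case (Suc s)
  have "dot f ((markov_op ^^ (Suc s + t)) f) = dot f ((markov_op ^^ (s + Suc t)) f)"
    by simp
  also have "\<dots> = dot ((markov_op ^^ s) f) (markov_op ((markov_op ^^ t) f))"
    using Suc[of "Suc t"] by simp
  finally show ?case by (simp add: dot_self_adjoint)
qed simp

text \<open>This replaces the spectral theorem. With N(s) the squared norm of the s-th iterate,
  Cauchy-Schwarz applied to an iterate and its image two steps later gives N(s+1)^2 \<le> N(s)
  N(s+2), so the ratios N(s+1)/N(s) never decrease; the first is at least r^2. By self-adjointness
  N(s) is the quadratic form of the power 2s, hence the even exponents.\<close>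

lemma dot_op_pow_ge:
  assumes pos: "0 < dot f f" and r: "0 < r" "dot f (markov_op f) = r * dot f f"
  shows "r ^ (2 * s) * dot f f \<le> dot f ((markov_op ^^ (2 * s)) f)"
proof -
  define N where "N s = dot ((markov_op ^^ s) f) ((markov_op ^^ s) f)" for s
  have step: "0 < N s \<and> r\<^sup>2 * N s \<le> N (Suc s)" for s
  proof (induction s)
    case 0
    have "(r * dot f f)\<^sup>2 \<le> dot f f * N 1"
      using dot_Cauchy_Schwarz[of f "markov_op f"] by (simp add: r N_def)
    then have "dot f f * (r\<^sup>2 * dot f f) \<le> dot f f * N 1"
      by (simp add: power2_eq_square mult_ac)
    then show ?case using pos by (simp add: N_def)
  next
    case (Suc s)
    let ?h = "(markov_op ^^ s) f"
    have pos': "0 < N (Suc s)"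
      using Suc r by (meson less_le_trans mult_pos_pos zero_less_power)
    have "(N (Suc s))\<^sup>2 \<le> N s * N (Suc (Suc s))"
      using dot_Cauchy_Schwarz[of ?h "markov_op (markov_op ?h)"]
      by (simp add: N_def dot_self_adjoint)
    moreover have "N (Suc s) * (r\<^sup>2 * N s) \<le> (N (Suc s))\<^sup>2"
      using Suc pos' by (simp add: power2_eq_square)
    ultimately have "N s * (r\<^sup>2 * N (Suc s)) \<le> N s * N (Suc (Suc s))"
      by (simp add: mult_ac)
    with Suc pos' show ?case by simp
  qed
  have "r ^ (2 * s) * N 0 \<le> N s" for s
  proof (induction s)
    case (Suc s)
    have "r ^ (2 * Suc s) * N 0 = r\<^sup>2 * (r ^ (2 * s) * N 0)"
      by (simp add: power_add mult_ac power2_eq_square)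
    also have "\<dots> \<le> r\<^sup>2 * N s" using Suc by (intro mult_left_mono) auto
    finally show ?case using step[of s] by linarith
  qed simp
  from this[of s] show ?thesis
    by (simp add: N_def mult_2 dot_op_pow)
qed

section \<open>From quadratic forms to total variation and mixing times\<close>

lemma chain_pow_closed: "x \<in> S \<Longrightarrow> set_pmf (chain_pow K t x) \<subseteq> S"
proof (induction t arbitrary: x)
  case (Suc t)
  have "set_pmf (chain_pow K t y) \<subseteq> S" if "y \<in> set_pmf (K x)" for y
    using kernel_closed[OF Suc.prems] that by (intro Suc.IH) blast
  then show ?case by (simp add: UN_least)
qed simp

lemma sum_chain_pow:
  "x \<in> S \<Longrightarrow> (\<Sum>y\<in>S. pmf (chain_pow K t x) y * f y) = (markov_op ^^ t) f x"
proof (induction t arbitrary: x)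
  case 0
  then have "(\<Sum>y\<in>S. pmf (return_pmf x) y * f y) = (\<Sum>y\<in>S. if x = y then f y else 0)"
    by (intro sum.cong refl) (simp add: indicator_def)
  with 0 finite_space show ?case by simp
next
  case (Suc t)
  have "pmf (chain_pow K (Suc t) x) y = (\<Sum>z\<in>S. pmf (K x) z * pmf (chain_pow K t z) y)" for y
    unfolding chain_pow.simps pmf_bind using kernel_closed[OF Suc.prems]
    by (subst integral_measure_pmf_real[OF finite_space]) (auto simp: mult.commute)
  then have "(\<Sum>y\<in>S. pmf (chain_pow K (Suc t) x) y * f y)
      = (\<Sum>y\<in>S. \<Sum>z\<in>S. pmf (K x) z * (pmf (chain_pow K t z) y * f y))"
    by (simp add: sum_distrib_right mult.assoc)
  also have "\<dots> = (\<Sum>z\<in>S. \<Sum>y\<in>S. pmf (K x) z * (pmf (chain_pow K t z) y * f y))"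
    by (rule sum.swap)
  also have "\<dots> = (\<Sum>z\<in>S. pmf (K x) z * (markov_op ^^ t) f z)"
    by (intro sum.cong refl) (simp add: Suc.IH flip: sum_distrib_left)
  finally show ?case by (simp add: markov_op_def[of "(markov_op ^^ t) f" x])
qed

text \<open>The difference of two probability measures has total mass zero, so its values on A and
  off A cancel and each is at most half the l1 norm.\<close>

lemma pow_minus_pi_le_distance:
  assumes "x \<in> S" "A \<subseteq> S"
  shows "(\<Sum>y\<in>A. pmf (chain_pow K t x) y) - sum \<pi> A \<le> distance_to_stationarity S K \<pi> t"
proof -
  let ?d = "\<lambda>y. pmf (chain_pow K t x) y - \<pi> y"
  have "(\<Sum>y\<in>S. pmf (chain_pow K t x) y) = 1"
    using finite_space chain_pow_closed assms by (intro sum_pmf_eq_1)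
  then have "sum ?d S = 0" by (simp add: sum_subtractf pi_sum)
  moreover have "sum ?d S = sum ?d A + sum ?d (S - A)" "sum (\<lambda>y. \<bar>?d y\<bar>) S = sum (\<lambda>y. \<bar>?d y\<bar>) A + sum (\<lambda>y. \<bar>?d y\<bar>) (S - A)"
    using assms finite_space by (metis (no_types, lifting) add.commute sum.subset_diff)+
  moreover have "\<bar>sum ?d A\<bar> \<le> sum (\<lambda>y. \<bar>?d y\<bar>) A" "\<bar>sum ?d (S - A)\<bar> \<le> sum (\<lambda>y. \<bar>?d y\<bar>) (S - A)"
    by (rule sum_abs)+
  ultimately have "sum ?d A \<le> 1 / 2 * sum (\<lambda>y. \<bar>?d y\<bar>) S" by linarith
  also have "\<dots> \<le> distance_to_stationarity S K \<pi> t"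
    unfolding distance_to_stationarity_def using assms finite_space by (intro Max_ge) auto
  finally show ?thesis by (simp add: sum_subtractf)
qed

text \<open>The test function \<open>f = 1\<^sub>A - \<pi>(A)\<close> has Rayleigh quotient \<open>r\<close>, and for even \<open>t\<close>
  log-convexity gives \<open>\<langle>f, P\<^sup>t f\<rangle> \<ge> r\<^sup>t \<langle>f, f\<rangle>\<close>; on the other hand \<open>\<langle>f, P\<^sup>t f\<rangle> = \<langle>1\<^sub>A, P\<^sup>t f\<rangle>\<close> is at most
  \<open>\<pi>(A)\<close> times the distance to stationarity.\<close>

lemma distance_ge:
  assumes A: "A \<subseteq> S" and D: "D \<subseteq> S"
    and stay: "\<And>x. x \<in> A - D \<Longrightarrow> set_pmf (K x) \<subseteq> A"
    and p: "p = sum \<pi> A" "0 < p" "p < 1"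
    and d: "sum \<pi> D \<le> \<delta> * (p * (1 - p))" "\<delta> < 1"
  shows "(1 - p) * (1 - \<delta>) ^ (2 * s) \<le> distance_to_stationarity S K \<pi> (2 * s)"
proof -
  define f where "f x = indicator A x - p" for x
  let ?I = "indicator A :: 'a \<Rightarrow> real"
  have finA: "finite A" using A finite_space finite_subset by blast
  have sumI: "(\<Sum>x\<in>S. h x * ?I x) = sum h A" for h
  proof -
    have "sum h A = (\<Sum>x\<in>S. if x \<in> A then h x else 0)"
      using A finite_space by (metis Int_absorb1 sum.inter_restrict)
    also have "\<dots> = (\<Sum>x\<in>S. h x * ?I x)"
      by (intro sum.cong) (auto simp: indicator_def)
    finally show ?thesis by simp
  qed
  have dotI: "dot ?I g = (\<Sum>x\<in>A. \<pi> x * g x)" for g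
    using sumI[of "\<lambda>x. \<pi> x * g x"] by (simp add: dot_def mult_ac)
  have one: "dot (\<lambda>x. 1) ?I = p"
    unfolding dot_commute[of "\<lambda>x. 1"] dotI by (simp add: p)
  have one_one: "dot (\<lambda>x. 1) (\<lambda>x. 1) = 1" by (simp add: dot_def pi_sum)
  have dot_f: "dot f g = dot ?I g - p * dot (\<lambda>x. 1) g" for g
    unfolding f_def dot_diff_left by (subst dot_const_left) simp
  have f0: "dot (\<lambda>x. 1) f = 0"
    unfolding dot_commute[of "\<lambda>x. 1" f] dot_f dot_commute[of ?I] one one_one by simp
  have fg: "dot f g = dot ?I g" if "dot (\<lambda>x. 1) g = 0" for g
    by (simp add: dot_f that)
  have If: "dot ?I f = p * (1 - p)"
    using dot_f[of ?I] by (simp add: dot_commute[of ?I f] one, simp add: dotI p algebra_simps)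
  have ff: "dot f f = p * (1 - p)" unfolding fg[OF f0] by (rule If)
  have opI: "markov_op ?I x = (\<Sum>y\<in>A. pmf (K x) y)" for x
    unfolding markov_op_def by (rule sumI)
  have "dot f (markov_op f) = dot ?I (markov_op f)"
    using dot_one_op_pow[of 1 f] f0 by (intro fg) simp
  also have "\<dots> = dot f (markov_op ?I)"
    unfolding dot_self_adjoint[of f] by (rule dot_commute)
  also have "\<dots> = dot ?I (markov_op ?I) - p * p"
    by (simp add: dot_f dot_one_op one)
  finally have fPf: "dot f (markov_op f) = dot ?I (markov_op ?I) - p * p" .
  \<comment> \<open>\<open>dot ?I (markov_op ?I)\<close> is the stationary probability that two
    consecutive states both lie in A. Off D the step stays in A surely; states of D are counted as
    if they always left.\<close>
  have "p - sum \<pi> D \<le> p - sum \<pi> (A \<inter> D)"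
    using D finite_space pi_nonneg by (intro diff_left_mono sum_mono2 finite_subset[OF D]) auto
  also have "\<dots> = (\<Sum>x\<in>A. \<pi> x - (if x \<in> D then \<pi> x else 0))"
    using finA by (simp add: sum_subtractf p sum.inter_restrict)
  also have "\<dots> \<le> (\<Sum>x\<in>A. \<pi> x * (\<Sum>y\<in>A. pmf (K x) y))"
  proof (intro sum_mono)
    fix x assume x: "x \<in> A"
    show "\<pi> x - (if x \<in> D then \<pi> x else 0) \<le> \<pi> x * (\<Sum>y\<in>A. pmf (K x) y)"
      using x stay[of x] pi_nonneg[of x] A finA
      by (auto simp: sum_pmf_eq_1 intro!: mult_nonneg_nonneg sum_nonneg)
  qed
  also have "\<dots> = dot ?I (markov_op ?I)"
    by (simp add: dotI opI)
  finally have "dot f (markov_op f) \<ge> (1 - \<delta>) * dot f f"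
    using d by (simp add: fPf ff algebra_simps)
  moreover define r where "r = dot f (markov_op f) / dot f f"
  moreover have ffpos: "0 < dot f f" using p by (simp add: ff)
  ultimately have r: "1 - \<delta> \<le> r" "dot f (markov_op f) = r * dot f f"
    by (simp_all add: le_divide_eq)
  have "(1 - \<delta>) ^ (2 * s) * (p * (1 - p)) \<le> r ^ (2 * s) * (p * (1 - p))"
    using r d p by (intro mult_right_mono power_mono) auto
  also have "\<dots> \<le> dot f ((markov_op ^^ (2 * s)) f)"
    using dot_op_pow_ge[OF ffpos _ r(2), of s] r d ff by simp
  also have "\<dots> = dot ?I ((markov_op ^^ (2 * s)) f)"
    by (intro fg) (simp add: dot_one_op_pow f0)
  also have "\<dots> = (\<Sum>x\<in>A. \<pi> x * (markov_op ^^ (2 * s)) f x)" by (rule dotI)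
  also have "\<dots> \<le> (\<Sum>x\<in>A. \<pi> x * distance_to_stationarity S K \<pi> (2 * s))"
  proof (intro sum_mono mult_left_mono)
    fix x assume "x \<in> A"
    then have x: "x \<in> S" using A by auto
    then show "0 \<le> \<pi> x" by (rule pi_nonneg)
    have "(\<Sum>y\<in>S. pmf (chain_pow K (2 * s) x) y) = 1"
      using finite_space chain_pow_closed x by (intro sum_pmf_eq_1)
    moreover have "(\<Sum>y\<in>S. pmf (chain_pow K (2 * s) x) y * ?I y) = (\<Sum>y\<in>A. pmf (chain_pow K (2 * s) x) y)"
      by (rule sumI)
    ultimately have "(markov_op ^^ (2 * s)) f x = (\<Sum>y\<in>A. pmf (chain_pow K (2 * s) x) y) - p"
      unfolding sum_chain_pow[OF x, symmetric] f_def
      by (simp add: right_diff_distrib sum_subtractf flip: sum_distrib_right)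
    then show "(markov_op ^^ (2 * s)) f x \<le> distance_to_stationarity S K \<pi> (2 * s)"
      using pow_minus_pi_le_distance[OF x A, of "2 * s"] p by simp
  qed
  also have "\<dots> = p * distance_to_stationarity S K \<pi> (2 * s)"
    by (simp add: p sum_distrib_right)
  finally have "p * ((1 - p) * (1 - \<delta>) ^ (2 * s)) \<le> p * distance_to_stationarity S K \<pi> (2 * s)"
    by (simp add: mult_ac)
  then show ?thesis using p by simp
qed

lemma mixing_time_ge:
  assumes A: "A \<subseteq> S" and D: "D \<subseteq> S"
    and stay: "\<And>x. x \<in> A - D \<Longrightarrow> set_pmf (K x) \<subseteq> A"
    and p: "0 < sum \<pi> A" "sum \<pi> A \<le> 1 / 3"
    and d: "sum \<pi> D \<le> 2 / 3 * \<delta> * sum \<pi> A" "0 < \<delta>" "\<delta> \<le> 1 / 20"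
    and \<epsilon>: "0 < \<epsilon>" "\<epsilon> \<le> 1 / 2"
  shows "ereal (ln (1 / \<epsilon>) / (20 * \<delta>)) \<le> ereal_of_enat (mixing_time S K \<pi> \<epsilon>)"
proof -
  have bound: "ln (1 / \<epsilon>) / (20 * \<delta>) \<le> real t"
    if t: "\<forall>t'\<ge>t. distance_to_stationarity S K \<pi> t' \<le> \<epsilon>" for t
  proof -
    \<comment> \<open>The even one of t and t + 1.\<close>
    obtain s where s: "t \<le> 2 * s" "2 * s \<le> Suc t"
      by (rule that[of "Suc t div 2"]) auto
    let ?p = "sum \<pi> A"
    have "2 / 3 * ?p \<le> ?p * (1 - ?p)"
      using p mult_right_mono[of "2 / 3" "1 - ?p" ?p] by (simp add: mult.commute)
    then have "\<delta> * (2 / 3 * ?p) \<le> \<delta> * (?p * (1 - ?p))" using d by (intro mult_left_mono) auto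
    then have "sum \<pi> D \<le> \<delta> * (?p * (1 - ?p))" using d(1) by linarith
    then have "(1 - ?p) * (1 - \<delta>) ^ (2 * s) \<le> distance_to_stationarity S K \<pi> (2 * s)"
      using p d by (intro distance_ge[OF A D stay refl]) auto
    also have "\<dots> \<le> \<epsilon>" using t s by auto
    finally have "(1 - ?p) * (1 - \<delta>) ^ (2 * s) \<le> \<epsilon>" .
    moreover have "(2 / 3) * (1 - \<delta>) ^ (2 * s) \<le> (1 - ?p) * (1 - \<delta>) ^ (2 * s)"
      using p d by (intro mult_right_mono) auto
    ultimately have "(2 / 3) * (1 - \<delta>) ^ (2 * s) \<le> \<epsilon>" by linarith
    then have "ln ((2 / 3) * (1 - \<delta>) ^ (2 * s)) \<le> ln \<epsilon>"
      using d \<epsilon> by (subst ln_le_cancel_iff) auto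
    then have "ln (1 / \<epsilon>) \<le> ln (3 / 2) + (2 * s) * (- ln (1 - \<delta>))"
      using d \<epsilon> by (simp add: ln_mult ln_div ln_realpow)
    moreover have "- ln (1 - \<delta>) \<le> 2 * \<delta>"
    proof -
      have "\<delta>\<^sup>2 \<le> \<delta> * (1 / 2)"
        unfolding power2_eq_square using d by (intro mult_left_mono) auto
      moreover have "- \<delta> - 2 * \<delta>\<^sup>2 \<le> ln (1 - \<delta>)"
        using d by (intro ln_one_minus_pos_lower_bound) auto
      ultimately show ?thesis by linarith
    qed
    then have "(2 * s) * (- ln (1 - \<delta>)) \<le> (real t + 1) * (2 * \<delta>)"
      using s d by (intro mult_mono) auto
    \<comment> \<open>That is (3/2)^5 \<le> 2^3. Since \<epsilon> \<le> 1/2, the loss from the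
      prefactor 2/3 then costs at most three fifths of ln (1/\<epsilon>). The extra 2\<delta> \<le>
      1/10 from rounding t up is absorbed through ln 2 \<ge> 2/3; the constant 20 leaves
      room.\<close>
    moreover have "ln (3 / 2) \<le> 3 / 5 * ln (2::real)"
    proof -
      have "real 5 * ln (3 / 2) = ln ((3 / 2) ^ 5)"
        by (rule ln_realpow[symmetric])
      moreover have "ln ((3 / 2) ^ 5) \<le> ln ((2 :: real) ^ 3)"
        by (rule ln_mono) (simp_all add: power_divide)
      moreover have "ln (2 ^ 3) = real 3 * ln 2"
        by (rule ln_realpow)
      ultimately show ?thesis by linarith
    qed
    moreover have "ln 2 \<le> ln (1 / \<epsilon>)"
      using \<epsilon> by (intro ln_mono) (auto simp: le_divide_eq)
    moreover have "2 / 3 \<le> ln (2::real)" by (rule ln2_ge_two_thirds)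
    moreover have "(real t + 1) * (2 * \<delta>) = 2 * (\<delta> * real t) + 2 * \<delta>" "0 \<le> \<delta> * real t"
      using d by (auto simp: algebra_simps)
    ultimately have "ln (1 / \<epsilon>) \<le> 20 * (\<delta> * real t)"
      using d by linarith
    then show ?thesis using d by (simp add: divide_le_eq mult_ac)
  qed
  let ?T = "{t. \<forall>t'\<ge>t. distance_to_stationarity S K \<pi> t' \<le> \<epsilon>}"
  show ?thesis
  proof (cases "?T = {}")
    case True
    then show ?thesis unfolding mixing_time_def True by (simp add: Inf_enat_def)
  next
    case False
    then obtain t\<^sub>0 where "enat t\<^sub>0 \<in> enat ` ?T" by blast
    then have "(LEAST e. e \<in> enat ` ?T) \<in> enat ` ?T" by (rule LeastI)
    then obtain t where t: "t \<in> ?T" "(LEAST e. e \<in> enat ` ?T) = enat t"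
      by blast
    have "mixing_time S K \<pi> \<epsilon> = enat t"
      unfolding mixing_time_def Inf_enat_def using False t(2) by simp
    moreover have "ln (1 / \<epsilon>) / (20 * \<delta>) \<le> real t"
      using bound t(1) by blast
    ultimately show ?thesis by simp
  qed
qed

end

section \<open>The exponential rate function\<close>

definition logit :: "real \<Rightarrow> real" where
  "logit u = ln (1 / 2 + u) - ln (1 / 2 - u)"

definition neg_entropy :: "real \<Rightarrow> real" where
  "neg_entropy u = (1 / 2 + u) * ln (1 / 2 + u) + (1 / 2 - u) * ln (1 / 2 - u)"

lemma deriv_logit:
  assumes "0 \<le> u" "u < 1 / 2"
  shows "(logit has_real_derivative (1 / (1 / 2 + u) + 1 / (1 / 2 - u))) (at u)"
  unfolding logit_def using assms by (auto intro!: derivative_eq_intros)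

lemma deriv_neg_entropy:
  assumes "0 \<le> u" "u < 1 / 2"
  shows "(neg_entropy has_real_derivative logit u) (at u)"
  unfolding neg_entropy_def logit_def
  using assms by (auto intro!: derivative_eq_intros)

lemma logit_convex: "convex_on {0..<1 / 2} logit"
proof (rule f''_ge0_imp_convex)
  show "convex {0..<1 / 2 :: real}" by simp
  fix u :: real assume "u \<in> {0..<1 / 2}"
  then have u: "0 \<le> u" "u < 1 / 2" by auto
  show "(logit has_real_derivative (1 / (1 / 2 + u) + 1 / (1 / 2 - u))) (at u)"
    using deriv_logit u by blast
  show "((\<lambda>u. 1 / (1 / 2 + u) + 1 / (1 / 2 - u)) has_real_derivative
          (1 / (1 / 2 - u)\<^sup>2 - 1 / (1 / 2 + u)\<^sup>2)) (at u)"
    using u by (auto intro!: derivative_eq_intros simp: power2_eq_square)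
  have "(1 / 2 - u)\<^sup>2 \<le> (1 / 2 + u)\<^sup>2" using u by (intro power_mono) auto
  then show "0 \<le> 1 / (1 / 2 - u)\<^sup>2 - 1 / (1 / 2 + u)\<^sup>2"
    using u by (simp add: frac_le)
qed

lemma logit_0: "logit 0 = 0"
  by (simp add: logit_def)

text \<open>A convex function vanishing at 0 has nondecreasing slope \<open>logit u / u\<close> seen
  from the origin.\<close>

lemma logit_star_shaped:
  assumes "0 \<le> u" "u \<le> c" "0 < c" "c < 1 / 2"
  shows "logit u \<le> u / c * logit c"
proof -
  have "logit ((1 - u / c) *\<^sub>R 0 + (u / c) *\<^sub>R c) \<le> (1 - u / c) * logit 0 + u / c * logit c"
    using assms by (intro convex_onD[OF logit_convex]) auto
  then show ?thesis using assms by (simp add: logit_0)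
qed

lemma logit_ge:
  assumes "0 \<le> u" "u < 1 / 2"
  shows "4 * u \<le> logit u"
proof -
  have "logit 0 - 4 * 0 \<le> logit u - 4 * u"
  proof (rule DERIV_nonneg_imp_nondecreasing[OF assms(1)])
    fix x assume x: "0 \<le> x" "x \<le> u"
    have "((\<lambda>x. logit x - 4 * x) has_real_derivative (1 / (1 / 2 + x) + 1 / (1 / 2 - x) - 4)) (at x)"
      using x assms by (auto intro!: derivative_eq_intros deriv_logit)
    moreover have "(1 / 2 + x) * (1 / 2 - x) \<le> 1 / 4" by (simp add: algebra_simps)
    then have "0 \<le> 1 / (1 / 2 + x) + 1 / (1 / 2 - x) - 4"
      using x assms by (simp add: divide_simps)
    ultimately show "\<exists>y. ((\<lambda>x. logit x - 4 * x) has_real_derivative y) (at x) \<and> 0 \<le> y"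
      by blast
  qed
  then show ?thesis by (simp add: logit_0)
qed

lemma logit_sixth: "logit (1 / 6) = ln 2"
  by (simp add: logit_def ln_div)

lemma neg_entropy_minus: "neg_entropy (- u) = neg_entropy u"
  by (simp add: neg_entropy_def)

lemma ln2_le: "ln (2 :: real) \<le> 3 / 4"
proof -
  have "ln (2 :: real) \<le> 25 / 36" by (rule ln2_le_25_over_36)
  then show ?thesis by simp
qed

lemma ln3_gap: "19 / 12 * ln 2 < ln (3 :: real)"
proof -
  have "ln ((2 :: real) ^ 19) < ln (3 ^ 12)" by (subst ln_less_cancel_iff) simp_all
  moreover have "ln ((2 :: real) ^ 19) = real 19 * ln 2" "ln ((3 :: real) ^ 12) = real 12 * ln 3"
    by (rule ln_realpow)+
  ultimately show ?thesis by linarith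
qed

text \<open>Pinsker's inequality for a biased against a fair coin. The end points are separate
  because the derivative does not exist there; \<open>ln 0\<close> only occurs multiplied by
  0.\<close>

lemma neg_entropy_ge:
  assumes "\<bar>u\<bar> \<le> 1 / 2"
  shows "2 * u\<^sup>2 - ln 2 \<le> neg_entropy u"
proof -
  have *: "2 * u\<^sup>2 - ln 2 \<le> neg_entropy u" if u: "0 \<le> u" "u < 1 / 2" for u
  proof -
    have "neg_entropy 0 - 2 * 0\<^sup>2 \<le> neg_entropy u - 2 * u\<^sup>2"
    proof (rule DERIV_nonneg_imp_nondecreasing[OF u(1)])
      fix x assume x: "0 \<le> x" "x \<le> u"
      have "((\<lambda>x. neg_entropy x - 2 * x\<^sup>2) has_real_derivative (logit x - 4 * x)) (at x)"
        using x u by (auto intro!: derivative_eq_intros deriv_neg_entropy)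
      then show "\<exists>y. ((\<lambda>x. neg_entropy x - 2 * x\<^sup>2) has_real_derivative y) (at x) \<and> 0 \<le> y"
        using logit_ge[of x] x u by auto
    qed
    then show ?thesis by (simp add: neg_entropy_def ln_div)
  qed
  have half: "2 * (1 / 2)\<^sup>2 - ln 2 \<le> neg_entropy (1 / 2)"
    using ln2_ge_two_thirds by (simp add: neg_entropy_def power2_eq_square)
  consider "u = 1 / 2" | "u = - (1 / 2)" | "0 \<le> u" "u < 1 / 2" | "0 \<le> - u" "- u < 1 / 2"
    using assms by linarith
  then show ?thesis
  proof cases
    case 1
    show ?thesis unfolding 1 by (rule half)
  next
    case 2
    show ?thesis unfolding 2 using half by (simp add: neg_entropy_minus)
  next
    case 3
    then show ?thesis by (rule *)
  next
    case 4
    then show ?thesis using *[of "- u"] by (simp add: neg_entropy_minus)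
  qed
qed

text \<open>With u = a - 1/2 the parabola touches the entropy at u = 1/6 and u = -1/6, that is at
  the fractions 2/3 and 1/3 of the ordered and disordered phases:
  \<open>logit (1 / 6) = ln 2\<close> is the slope of the parabola there. As
  \<open>logit u / u\<close> is nondecreasing, the difference falls before 1/6 and rises after
  it.\<close>

lemma neg_entropy_ge_tangent:
  assumes "\<bar>u\<bar> \<le> 1 / 2"
  shows "3 * ln 2 * u\<^sup>2 + 7 / 12 * ln 2 - ln 3 \<le> neg_entropy u"
proof -
  define G where "G u = neg_entropy u - 3 * ln 2 * u\<^sup>2" for u
  have deriv: "(G has_real_derivative (logit u - 6 * ln 2 * u)) (at u)" if "0 \<le> u" "u < 1 / 2" for u
    unfolding G_def using that by (auto intro!: derivative_eq_intros deriv_neg_entropy)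
  have "neg_entropy (1 / 6) = 2 / 3 * ln (2 / 3) + 1 / 3 * ln (1 / 3)"
    by (simp add: neg_entropy_def)
  then have G6: "G (1 / 6) = 7 / 12 * ln 2 - ln 3"
    by (simp add: G_def ln_div power2_eq_square algebra_simps)
  have *: "G (1 / 6) \<le> G u" if u: "0 \<le> u" "u < 1 / 2" for u
  proof (cases "u \<le> 1 / 6")
    case True
    show ?thesis
    proof (rule DERIV_nonpos_imp_nonincreasing[OF True])
      fix x assume "u \<le> x" "x \<le> 1 / 6"
      then have x: "0 \<le> x" "x \<le> 1 / 6" using u by auto
      then show "\<exists>y. (G has_real_derivative y) (at x) \<and> y \<le> 0"
        using deriv[of x] logit_star_shaped[of x "1 / 6"] by (auto simp: logit_sixth mult_ac)
    qed
  next
    case False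
    show ?thesis
    proof (rule DERIV_nonneg_imp_nondecreasing[where f = G])
      show "1 / 6 \<le> u" using False by simp
      fix x assume x: "1 / 6 \<le> x" "x \<le> u"
      then have "ln 2 \<le> 1 / 6 / x * logit x"
        using logit_star_shaped[of "1 / 6" x] u by (simp add: logit_sixth)
      then have "6 * ln 2 * x \<le> logit x" using x by (simp add: field_simps)
      then show "\<exists>y. (G has_real_derivative y) (at x) \<and> 0 \<le> y"
        using deriv[of x] x u by auto
    qed
  qed
  \<comment> \<open>Here the claim is 4/3 ln 2 \<le> ln 3, weaker than
    \<open>ln3_gap\<close>.\<close>
  have half: "G (1 / 6) \<le> G (1 / 2)"
  proof -
    have "G (1 / 2) = - (3 / 4 * ln 2)" by (simp add: G_def neg_entropy_def power2_eq_square)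
    then show ?thesis using ln3_gap G6 ln2_ge_two_thirds by linarith
  qed
  have even: "G (- u) = G u" for u by (simp add: G_def neg_entropy_minus)
  consider "u = 1 / 2" | "u = - (1 / 2)" | "0 \<le> u" "u < 1 / 2" | "0 \<le> - u" "- u < 1 / 2"
    using assms by linarith
  then have "G (1 / 6) \<le> G u"
  proof cases
    case 1
    show ?thesis unfolding 1 by (rule half)
  next
    case 2
    show ?thesis unfolding 2 using half by (simp add: even)
  next
    case 3
    then show ?thesis by (rule *)
  next
    case 4
    then show ?thesis using *[of "- u"] by (simp add: even)
  qed
  then show ?thesis unfolding G6 by (simp add: G_def)
qed

section \<open>Maximising the rate over the colour fractions\<close>

lemma entropy_split:
  assumes "0 \<le> a" "0 \<le> b" "0 < t" "a + b = t"
  shows "a * ln a + b * ln b = t * ln t + t * neg_entropy ((a - b) / (2 * t))"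
proof -
  have eq: "1 / 2 + (a - b) / (2 * t) = a / t" "1 / 2 - (a - b) / (2 * t) = b / t"
    using assms by (auto simp: field_simps)
  have scale: "t * (c / t * ln (c / t)) = c * ln c - c * ln t" if "0 \<le> c" for c
    using that assms by (cases "c = 0") (simp_all add: ln_div right_diff_distrib)
  have "t * neg_entropy ((a - b) / (2 * t)) = a * ln a - a * ln t + (b * ln b - b * ln t)"
    unfolding neg_entropy_def eq distrib_left using assms by (simp only: scale)
  also have "\<dots> = a * ln a + b * ln b - (a + b) * ln t" by (simp add: algebra_simps)
  finally show ?thesis using assms by simp
qed

text \<open>Exponential rate of the total weight of the configurations with colour fractions
  \<open>a, b, c\<close> at the inverse temperature \<open>4 ln 2 / n\<close>.\<close>

definition rate :: "real \<Rightarrow> real \<Rightarrow> real \<Rightarrow> real" where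
  "rate a b c = 2 * ln 2 * (a\<^sup>2 + b\<^sup>2 + c\<^sup>2) - (a * ln a + b * ln b + c * ln c)"

text \<open>As \<open>b + c \<le> 2 / 3\<close>, the entropy is strong enough to make \<open>b = c\<close> optimal.\<close>

lemma rate_le:
  assumes "0 \<le> b" "0 \<le> c" "a + b + c = 1" "1 / 3 \<le> a"
  shows "rate a b c \<le> ln 2 * (5 / 4 + 3 * (a - 1 / 2)\<^sup>2) - neg_entropy (a - 1 / 2)"
proof (cases "b + c = 0")
  case True
  with assms have "a = 1" "b = 0" "c = 0" by auto
  then show ?thesis by (simp add: rate_def neg_entropy_def power2_eq_square)
next
  case False
  define t where "t = b + c"
  define u where "u = (b - c) / (2 * t)"
  have t: "0 < t" "t \<le> 2 / 3" "a = 1 - t" using False assms by (auto simp: t_def)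
  have bc: "b = t * (1 / 2 + u)" "c = t * (1 / 2 - u)"
    using t by (auto simp: u_def t_def field_simps)
  have u: "\<bar>u\<bar> \<le> 1 / 2"
  proof -
    have "\<bar>b - c\<bar> \<le> t" using assms by (simp add: t_def abs_le_iff)
    then show ?thesis using t by (simp add: u_def divide_le_eq)
  qed
  have "b * ln b + c * ln c = t * ln t + t * neg_entropy u"
    unfolding u_def by (rule entropy_split) (use assms t in \<open>auto simp: t_def\<close>)
  also have "\<dots> \<ge> t * ln t + t * (2 * u\<^sup>2 - ln 2)"
    using neg_entropy_ge[OF u] t by simp
  finally have ent: "t * ln t + 2 * t * u\<^sup>2 - t * ln 2 \<le> b * ln b + c * ln c"
    by (simp add: algebra_simps)
  have "neg_entropy (a - 1 / 2) = a * ln a + t * ln t"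
    using t by (simp add: neg_entropy_def)
  moreover have "4 * ln 2 * t\<^sup>2 * u\<^sup>2 \<le> 2 * t * u\<^sup>2"
  proof -
    have "2 * ln 2 * t \<le> 1"
    proof -
      have "ln 2 * t \<le> 3 / 4 * (2 / 3)"
        using ln2_le t by (intro mult_mono) auto
      then show ?thesis by simp
    qed
    then have "(2 * t * u\<^sup>2) * (2 * ln 2 * t) \<le> (2 * t * u\<^sup>2) * 1"
      using t by (intro mult_left_mono) auto
    then show ?thesis by (simp add: power2_eq_square mult_ac)
  qed
  \<comment> \<open>The summand \<open>t * ln 2\<close> is the entropy of an even split of t. With
    it the linear terms in a - 1/2 cancel; the last term is the energy gained by an uneven split,
    just shown to be outweighed by the entropy lost.\<close>
  moreover have "2 * ln 2 * (a\<^sup>2 + b\<^sup>2 + c\<^sup>2) + t * ln 2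
      = ln 2 * (5 / 4 + 3 * (a - 1 / 2)\<^sup>2) + 4 * ln 2 * t\<^sup>2 * u\<^sup>2"
    unfolding bc t(3) by (simp add: power2_eq_square algebra_simps)
  ultimately show ?thesis using ent unfolding rate_def by linarith
qed

lemma rate_commute: "rate a b c = rate b a c" "rate a b c = rate c b a"
  by (simp_all add: rate_def)

lemma rate_le_max:
  assumes "0 \<le> a" "0 \<le> b" "0 \<le> c" "a + b + c = 1"
  shows "rate a b c \<le> ln 3 + 2 / 3 * ln 2"
proof -
  have *: "rate a b c \<le> ln 3 + 2 / 3 * ln 2"
    if "0 \<le> b" "0 \<le> c" "a + b + c = 1" "1 / 3 \<le> a" for a b c
  proof -
    have "rate a b c \<le> ln 2 * (5 / 4 + 3 * (a - 1 / 2)\<^sup>2) - neg_entropy (a - 1 / 2)"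
      using that by (rule rate_le)
    also have "\<dots> \<le> ln 3 + 2 / 3 * ln 2"
    proof -
      have "\<bar>a - 1 / 2\<bar> \<le> 1 / 2" using that by linarith
      from neg_entropy_ge_tangent[OF this] show ?thesis by (simp add: algebra_simps)
    qed
    finally show ?thesis .
  qed
  consider "1 / 3 \<le> a" | "1 / 3 \<le> b" | "1 / 3 \<le> c" using assms by linarith
  then show ?thesis
    using *[of b c a] *[of a c b] *[of b a c] assms rate_commute by cases auto
qed

text \<open>The cut has width d = 1/n, so an error of order d^2 in the rate is harmless even after
  multiplication by n. The bound d \<le> 1/6 guarantees the fraction 1/3 that \<open>rate_le\<close>
  asks for.\<close>

lemma rate_le_boundary:
  assumes "0 \<le> a" "0 \<le> b" "0 \<le> c" "a + b + c = 1"
    and "\<bar>a - 1 / 2\<bar> \<le> d \<or> \<bar>b - 1 / 2\<bar> \<le> d \<or> \<bar>c - 1 / 2\<bar> \<le> d" "d \<le> 1 / 6"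
  shows "rate a b c \<le> 9 / 4 * ln 2 + 3 * ln 2 * d\<^sup>2"
proof -
  have *: "rate a b c \<le> 9 / 4 * ln 2 + 3 * ln 2 * d\<^sup>2"
    if "0 \<le> b" "0 \<le> c" "a + b + c = 1" "\<bar>a - 1 / 2\<bar> \<le> d" for a b c
  proof -
    let ?v = "(a - 1 / 2)\<^sup>2"
    have "rate a b c \<le> ln 2 * (5 / 4 + 3 * ?v) - neg_entropy (a - 1 / 2)"
      using that assms(6) by (intro rate_le) (auto simp: abs_le_iff)
    also have "\<dots> \<le> ln 2 * (5 / 4 + 3 * ?v) + ln 2 - 2 * ?v"
      using neg_entropy_ge[of "a - 1 / 2"] that assms(6) by (simp add: abs_le_iff)
    also have "\<dots> \<le> 9 / 4 * ln 2 + 3 * ln 2 * ?v" by (simp add: algebra_simps)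
    also have "\<dots> \<le> 9 / 4 * ln 2 + 3 * ln 2 * d\<^sup>2"
      using power_mono[OF that(4), of 2] by (intro add_left_mono mult_left_mono) auto
    finally show ?thesis .
  qed
  from assms(5) show ?thesis
    using *[of b c a] *[of a c b] *[of b a c] assms rate_commute by (elim disjE) auto
qed

section \<open>Gibbs weights of the phases\<close>

definition colour_count :: "nat \<Rightarrow> nat \<Rightarrow> config \<Rightarrow> nat" where
  "colour_count n c x = card {v \<in> {1..n}. x v = c}"

lemma finite_configs [simp]: "finite (configs n)"
  unfolding configs_def by (intro finite_PiE) auto

lemma card_configs: "card (configs n) = 3 ^ n"
  unfolding configs_def by (subst card_PiE) (auto simp: numeral_3_eq_3)

lemma configs_colour: "x \<in> configs n \<Longrightarrow> v \<in> {1..n} \<Longrightarrow> x v \<in> {1, 2, 3}"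
  unfolding configs_def by (rule PiE_mem)

lemma of_nat_colour_count: "real (colour_count n c x) = (\<Sum>v\<in>{1..n}. of_bool (x v = c))"
  unfolding colour_count_def by (simp add: Int_def)

lemma sum_colour_count:
  assumes "x \<in> configs n"
  shows "(\<Sum>c\<in>{1, 2, 3}. real (colour_count n c x)) = real n"
proof -
  have "(\<Sum>c\<in>{1, 2, 3}. real (colour_count n c x))
      = (\<Sum>v\<in>{1..n}. \<Sum>c\<in>{1, 2, 3}. of_bool (x v = c))"
    unfolding of_nat_colour_count by (rule sum.swap)
  also have "\<dots> = (\<Sum>v\<in>{1..n}. 1)"
    using configs_colour[OF assms] by (intro sum.cong) auto
  finally show ?thesis by simp
qed

lemma sum_pairs_symmetric:
  fixes e :: "nat \<Rightarrow> nat \<Rightarrow> real"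
  assumes "\<And>i j. e i j = e j i"
  shows "(\<Sum>i\<in>{1..n}. \<Sum>j\<in>{1..n}. e i j)
    = 2 * (\<Sum>i\<in>{1..n}. \<Sum>j\<in>{i<..n}. e i j) + (\<Sum>i\<in>{1..n}. e i i)"
proof (induction n)
  case (Suc n)
  have "(\<Sum>j\<in>{i<..Suc n}. e i j) = (\<Sum>j\<in>{i<..n}. e i j) + e i (Suc n)" if "i \<in> {1..n}" for i
  proof -
    have "{i<..Suc n} = insert (Suc n) {i<..n}" using that by auto
    then show ?thesis by simp
  qed
  then have "(\<Sum>i\<in>{1..Suc n}. \<Sum>j\<in>{i<..Suc n}. e i j)
      = (\<Sum>i\<in>{1..n}. \<Sum>j\<in>{i<..n}. e i j) + (\<Sum>i\<in>{1..n}. e i (Suc n))"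
    by (simp add: sum.distrib)
  moreover have "(\<Sum>j\<in>{1..n}. e (Suc n) j) = (\<Sum>i\<in>{1..n}. e i (Suc n))"
    using assms by simp
  ultimately show ?case using Suc.IH by (simp add: sum.distrib)
qed simp

text \<open>The squared counts enumerate ordered pairs of equal colour, each unordered pair twice,
  together with the n diagonal pairs.\<close>

lemma hamiltonian_colour_count:
  assumes x: "x \<in> configs n"
  shows "hamiltonian n x = ((\<Sum>c\<in>{1, 2, 3}. (real (colour_count n c x))\<^sup>2) - real n) / 2"
proof -
  have "(\<Sum>c\<in>{1, 2, 3}. (real (colour_count n c x))\<^sup>2)
      = (\<Sum>c\<in>{1, 2, 3}. \<Sum>i\<in>{1..n}. \<Sum>j\<in>{1..n}. of_bool (x i = c) * of_bool (x j = c))"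
    unfolding of_nat_colour_count power2_eq_square sum_product ..
  also have "\<dots> = (\<Sum>i\<in>{1..n}. \<Sum>c\<in>{1, 2, 3}. \<Sum>j\<in>{1..n}. of_bool (x i = c) * of_bool (x j = c))"
    by (rule sum.swap)
  also have "\<dots> = (\<Sum>i\<in>{1..n}. \<Sum>j\<in>{1..n}. \<Sum>c\<in>{1, 2, 3}. of_bool (x i = c) * of_bool (x j = c))"
    by (intro sum.cong refl sum.swap)
  also have "\<dots> = (\<Sum>i\<in>{1..n}. \<Sum>j\<in>{1..n}. of_bool (x i = x j))"
  proof (intro sum.cong refl)
    fix i j assume "i \<in> {1..n}" "j \<in> {1..n}"
    then show "(\<Sum>c\<in>{1, 2, 3}. of_bool (x i = c) * of_bool (x j = c)) = (of_bool (x i = x j) :: real)"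
      using configs_colour[OF x, of i] configs_colour[OF x, of j] by auto
  qed
  also have "\<dots> = 2 * hamiltonian n x + real n"
    unfolding hamiltonian_def by (subst sum_pairs_symmetric) auto
  finally show ?thesis by simp
qed

lemma prod_configs_colour:
  fixes g :: "nat \<Rightarrow> real"
  assumes x: "x \<in> configs n"
  shows "(\<Prod>v\<in>{1..n}. g (x v)) = (\<Prod>c\<in>{1, 2, 3}. g c ^ colour_count n c x)"
proof -
  have "g c ^ colour_count n c x = (\<Prod>v\<in>{1..n}. if x v = c then g c else 1)" for c
    by (simp add: colour_count_def prod.If_cases Int_def)
  then have "(\<Prod>c\<in>{1, 2, 3}. g c ^ colour_count n c x)
      = (\<Prod>v\<in>{1..n}. \<Prod>c\<in>{1, 2, 3}. if x v = c then g c else 1)"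
    by (simp only: prod.swap[of _ "{1..n}"])
  also have "\<dots> = (\<Prod>v\<in>{1..n}. g (x v))"
    using configs_colour[OF x] by (intro prod.cong) auto
  finally show ?thesis by simp
qed

lemma sum_configs_prod:
  fixes g :: "nat \<Rightarrow> real"
  shows "(\<Sum>x\<in>configs n. \<Prod>v\<in>{1..n}. g (x v)) = (g 1 + g 2 + g 3) ^ n"
proof -
  have "(\<Sum>x\<in>configs n. \<Prod>v\<in>{1..n}. g (x v)) = (\<Prod>v\<in>{1..n}. \<Sum>c\<in>{1, 2, 3}. g c)"
    unfolding configs_def by (rule prod_sum_PiE[symmetric]) auto
  then show ?thesis by (simp add: add.assoc)
qed

text \<open>The product measure built from its own colour fractions gives \<open>x\<close> the mass
  \<open>\<Prod>\<^sub>v k(x\<^sub>v) / n\<close>; for each of the at most \<open>(n + 1)\<^sup>3\<close> colour statistics \<open>k\<close> these masses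
  belong to one probability measure.\<close>

lemma sum_likelihood_le:
  assumes "n \<ge> 1"
  shows "(\<Sum>x\<in>configs n. \<Prod>v\<in>{1..n}. real (colour_count n (x v) x) / real n) \<le> (real n + 1) ^ 3"
    (is "(\<Sum>x\<in>_. ?F x) \<le> _")
proof -
  define ty where "ty x = (colour_count n 1 x, colour_count n 2 x, colour_count n 3 x)" for x
  let ?T = "ty ` configs n"
  have le: "colour_count n c x \<le> n" for c x
    unfolding colour_count_def by (rule order_trans[OF card_mono[of "{1..n}"]]) auto
  have mass_le: "(\<Sum>x | x \<in> configs n \<and> ty x = k. ?F x) \<le> 1" if "k \<in> ?T" for k
  proof -
    obtain y where y: "y \<in> configs n" "k = ty y" using \<open>k \<in> ?T\<close> by blast
    define g where "g c = real (colour_count n c y) / real n" for c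
    have "?F x = (\<Prod>v\<in>{1..n}. g (x v))" if "x \<in> configs n" "ty x = k" for x
      using that y configs_colour[OF that(1)]
      by (intro prod.cong) (fastforce simp: g_def ty_def)+
    then have "(\<Sum>x | x \<in> configs n \<and> ty x = k. ?F x)
        = (\<Sum>x | x \<in> configs n \<and> ty x = k. \<Prod>v\<in>{1..n}. g (x v))"
      by (intro sum.cong) auto
    also have "\<dots> \<le> (\<Sum>x\<in>configs n. \<Prod>v\<in>{1..n}. g (x v))"
      by (intro sum_mono2) (auto simp: g_def intro!: prod_nonneg)
    also have "\<dots> = (g 1 + g 2 + g 3) ^ n" by (rule sum_configs_prod)
    also have "g 1 + g 2 + g 3 = 1"
      using sum_colour_count[OF y(1)] assms by (simp add: g_def flip: add_divide_distrib)
    finally show ?thesis by simp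
  qed
  have "(\<Sum>x\<in>configs n. ?F x) = (\<Sum>k\<in>?T. \<Sum>x | x \<in> configs n \<and> ty x = k. ?F x)"
    by (rule sum.image_gen) simp
  also have "\<dots> \<le> (\<Sum>k\<in>?T. 1)" by (intro sum_mono mass_le)
  also have "\<dots> = real (card ?T)" by simp
  also have "\<dots> \<le> real (card ({0..n} \<times> {0..n} \<times> {0..n}))"
    using le by (intro of_nat_mono card_mono) (auto simp: ty_def)
  also have "\<dots> = (real n + 1) ^ 3" by (simp add: power3_eq_cube algebra_simps)
  finally show ?thesis .
qed

text \<open>The energy \<open>H\<close> up to an additive constant that makes it nonnegative.\<close>

definition excess_energy :: "nat \<Rightarrow> config \<Rightarrow> real" where
  "excess_energy n x = ((\<Sum>c\<in>{1, 2, 3}. (real (colour_count n c x))\<^sup>2) - (real n)\<^sup>2 / 3) / 2"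

lemma excess_energy_nonneg:
  assumes "x \<in> configs n"
  shows "0 \<le> excess_energy n x"
proof -
  define a b c where "a = real (colour_count n 1 x)" "b = real (colour_count n 2 x)"
    "c = real (colour_count n 3 x)"
  have "real n = a + b + c"
    using sum_colour_count[OF assms] by (simp add: a_b_c_def)
  moreover have "0 \<le> (a - b)\<^sup>2 + (b - c)\<^sup>2 + (a - c)\<^sup>2" by simp
  then have "(a + b + c)\<^sup>2 \<le> 3 * (a\<^sup>2 + b\<^sup>2 + c\<^sup>2)"
    by (simp add: power2_eq_square algebra_simps)
  ultimately show ?thesis
    unfolding excess_energy_def by (simp flip: a_b_c_def add: add.assoc del: One_nat_def)
qed

lemma gibbs_excess_energy:
  assumes "x \<in> configs n"
  shows "gibbs n \<beta> x = exp (\<beta> * excess_energy n x) / (\<Sum>y\<in>configs n. exp (\<beta> * excess_energy n y))"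
proof -
  define s where "s = exp (\<beta> * ((real n)\<^sup>2 / 3 - real n) / 2)"
  have *: "exp (\<beta> * hamiltonian n y) = s * exp (\<beta> * excess_energy n y)" if "y \<in> configs n" for y
  proof -
    have "\<beta> * hamiltonian n y = \<beta> * ((real n)\<^sup>2 / 3 - real n) / 2 + \<beta> * excess_energy n y"
      unfolding hamiltonian_colour_count[OF that] excess_energy_def by (simp add: field_simps)
    then show ?thesis by (simp add: s_def exp_add)
  qed
  have "partition_function n \<beta> = s * (\<Sum>y\<in>configs n. exp (\<beta> * excess_energy n y))"
    unfolding partition_function_def sum_distrib_left by (intro sum.cong refl *)
  moreover have "s \<noteq> 0" by (simp add: s_def)
  ultimately show ?thesis by (simp add: gibbs_def *[OF assms])
qed

lemma configs_nonempty: "configs n \<noteq> {}"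
  using card_configs[of n] by auto

text \<open>The shifted energy is nonnegative, so the sum is smallest at \<beta> = 0, where it is
  the number of configurations.\<close>

lemma sum_exp_excess_energy_ge:
  assumes "0 \<le> \<beta>"
  shows "3 ^ n \<le> (\<Sum>y\<in>configs n. exp (\<beta> * excess_energy n y))"
proof -
  have "(\<Sum>y\<in>configs n. 1) \<le> (\<Sum>y\<in>configs n. exp (\<beta> * excess_energy n y))"
    using assms excess_energy_nonneg by (intro sum_mono) simp
  then show ?thesis by (simp add: card_configs)
qed

lemma exp_excess_energy_le:
  assumes x: "x \<in> configs n" and n: "n \<ge> 1" and \<beta>: "\<beta> \<le> beta_crit n"
    and rate: "rate (colour_count n 1 x / n) (colour_count n 2 x / n) (colour_count n 3 x / n) \<le> r"
  shows "exp (\<beta> * excess_energy n x)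
    \<le> exp (real n * (r - 2 / 3 * ln 2)) * (\<Prod>v\<in>{1..n}. real (colour_count n (x v) x) / real n)"
proof -
  define k where "k c = real (colour_count n c x)" for c
  define a where "a c = k c / real n" for c
  have pow: "a c ^ colour_count n c x = exp (k c * ln (a c))" for c
  \<comment> \<open>A missing colour contributes 0 ^ 0 = 1 on the left and exp 0 on the
    right.\<close>
  proof (cases "colour_count n c x = 0")
    case False
    then have "a c = exp (ln (a c))" using n by (simp add: a_def k_def)
    then have "a c ^ colour_count n c x = exp (ln (a c)) ^ colour_count n c x" by simp
    then show ?thesis by (simp add: k_def exp_of_nat_mult)
  qed (simp add: k_def)
  have "\<beta> * excess_energy n x \<le> beta_crit n * excess_energy n x"
    using \<beta> excess_energy_nonneg[OF x] by (rule mult_right_mono)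
  also have "\<dots> = real n * (2 * ln 2 * ((a 1)\<^sup>2 + (a 2)\<^sup>2 + (a 3)\<^sup>2) - 2 / 3 * ln 2)"
    using n unfolding excess_energy_def beta_crit_def
    by (simp add: a_def k_def field_simps power2_eq_square)
  also have "\<dots> = real n * (rate (a 1) (a 2) (a 3) - 2 / 3 * ln 2)
      + (\<Sum>c\<in>{1, 2, 3}. k c * ln (a c))"
    using n by (simp add: rate_def a_def algebra_simps)
  also have "\<dots> \<le> real n * (r - 2 / 3 * ln 2) + (\<Sum>c\<in>{1, 2, 3}. k c * ln (a c))"
    using rate by (intro add_right_mono mult_left_mono diff_right_mono) (simp_all add: a_def k_def)
  finally have "exp (\<beta> * excess_energy n x)
      \<le> exp (real n * (r - 2 / 3 * ln 2) + (\<Sum>c\<in>{1, 2, 3}. k c * ln (a c)))"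
    by simp
  also have "\<dots> = exp (real n * (r - 2 / 3 * ln 2)) * (\<Prod>c\<in>{1, 2, 3}. a c ^ colour_count n c x)"
    unfolding pow exp_add by (simp add: exp_add)
  also have "(\<Prod>c\<in>{1, 2, 3}. a c ^ colour_count n c x) = (\<Prod>v\<in>{1..n}. a (x v))"
    by (rule prod_configs_colour[OF x, symmetric])
  finally show ?thesis by (simp add: a_def k_def)
qed

lemma sum_exp_excess_energy_le:
  assumes D: "D \<subseteq> configs n" and n: "n \<ge> 1" and \<beta>: "\<beta> \<le> beta_crit n"
    and rate: "\<And>x. x \<in> D \<Longrightarrow>
      rate (colour_count n 1 x / n) (colour_count n 2 x / n) (colour_count n 3 x / n) \<le> r"
  shows "(\<Sum>x\<in>D. exp (\<beta> * excess_energy n x)) \<le> (real n + 1) ^ 3 * exp (real n * (r - 2 / 3 * ln 2))"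
proof -
  let ?F = "\<lambda>x. \<Prod>v\<in>{1..n}. real (colour_count n (x v) x) / real n"
  have "(\<Sum>x\<in>D. exp (\<beta> * excess_energy n x)) \<le> (\<Sum>x\<in>D. exp (real n * (r - 2 / 3 * ln 2)) * ?F x)"
    using D by (intro sum_mono exp_excess_energy_le n \<beta> rate) auto
  also have "\<dots> \<le> (\<Sum>x\<in>configs n. exp (real n * (r - 2 / 3 * ln 2)) * ?F x)"
    using D by (intro sum_mono2) (auto intro!: mult_nonneg_nonneg prod_nonneg)
  also have "\<dots> = exp (real n * (r - 2 / 3 * ln 2)) * (\<Sum>x\<in>configs n. ?F x)"
    by (simp add: sum_distrib_left)
  also have "\<dots> \<le> exp (real n * (r - 2 / 3 * ln 2)) * (real n + 1) ^ 3"
    using sum_likelihood_le[OF n] by (intro mult_left_mono) auto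
  finally show ?thesis by (simp add: mult.commute)
qed

section \<open>The phases, the cut and their Gibbs mass\<close>

definition boundary :: "nat \<Rightarrow> config set" where
  "boundary n = {x \<in> configs n.
     \<exists>c\<in>{1, 2, 3}. n \<le> 2 * colour_count n c x + 1 \<and> 2 * colour_count n c x \<le> n + 2}"

definition ordered :: "nat \<Rightarrow> nat \<Rightarrow> config set" where
  "ordered n c = {x \<in> configs n. n < 2 * colour_count n c x}"

definition gap :: real where
  "gap = ln 3 - 19 / 12 * ln 2"

lemma gap_pos: "0 < gap"
  using ln3_gap by (simp add: gap_def)

lemma colour_fractions:
  assumes "x \<in> configs n" "n \<ge> 1"
  shows "real (colour_count n 1 x) / n + real (colour_count n 2 x) / n + real (colour_count n 3 x) / n = 1"
  using sum_colour_count[OF assms(1)] assms(2) by (simp flip: add_divide_distrib)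

lemma gibbs_boundary_le:
  assumes n: "n \<ge> 6" and \<beta>: "0 \<le> \<beta>" "\<beta> \<le> beta_crit n"
  shows "sum (gibbs n \<beta>) (boundary n) \<le> 8 * (real n + 1) ^ 3 * exp (- gap * n)"
proof -
  let ?Z = "\<Sum>y\<in>configs n. exp (\<beta> * excess_energy n y)"
  let ?r = "9 / 4 * ln 2 + 3 * ln 2 * (1 / real n)\<^sup>2"
  have sub: "boundary n \<subseteq> configs n" by (auto simp: boundary_def)
  have Z: "3 ^ n \<le> ?Z" using \<beta> by (intro sum_exp_excess_energy_ge)
  have rate: "rate (colour_count n 1 x / n) (colour_count n 2 x / n) (colour_count n 3 x / n) \<le> ?r"
    if "x \<in> boundary n" for x
  proof (rule rate_le_boundary)
    have "\<bar>real (colour_count n c x) / n - 1 / 2\<bar> \<le> 1 / n"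
      if "n \<le> 2 * colour_count n c x + 1" "2 * colour_count n c x \<le> n + 2" for c
    proof -
      have "real n \<le> 2 * real (colour_count n c x) + 1" "2 * real (colour_count n c x) \<le> real n + 2"
        using that by linarith+
      then have "\<bar>real (colour_count n c x) - n / 2\<bar> \<le> 1" by linarith
      then have "\<bar>real (colour_count n c x) - n / 2\<bar> / n \<le> 1 / n" by (rule divide_right_mono) simp
      moreover have "real (colour_count n c x) / n - 1 / 2 = (real (colour_count n c x) - n / 2) / n"
        using n by (simp add: diff_divide_distrib)
      ultimately show ?thesis by simp
    qed
    with that show "\<bar>real (colour_count n 1 x) / n - 1 / 2\<bar> \<le> 1 / n \<or>
        \<bar>real (colour_count n 2 x) / n - 1 / 2\<bar> \<le> 1 / n \<or>
        \<bar>real (colour_count n 3 x) / n - 1 / 2\<bar> \<le> 1 / n"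
      unfolding boundary_def by blast
    show "real (colour_count n 1 x) / n + real (colour_count n 2 x) / n + real (colour_count n 3 x) / n = 1"
      using that sub n by (intro colour_fractions) auto
    show "1 / real n \<le> 1 / 6" using n by (intro divide_left_mono) auto
  qed auto
  have "sum (gibbs n \<beta>) (boundary n) = (\<Sum>x\<in>boundary n. exp (\<beta> * excess_energy n x)) / ?Z"
    unfolding sum_divide_distrib using sub by (intro sum.cong refl gibbs_excess_energy) auto
  also have "\<dots> \<le> ((real n + 1) ^ 3 * exp (real n * (?r - 2 / 3 * ln 2))) / 3 ^ n"
    using sum_exp_excess_energy_le[OF sub _ \<beta>(2) rate] Z n by (intro frac_le) auto
  also have "(3 :: real) ^ n = exp (real n * ln 3)" by (simp add: exp_of_nat_mult)
  also have "(real n + 1) ^ 3 * exp (real n * (?r - 2 / 3 * ln 2)) / exp (real n * ln 3)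
      = (real n + 1) ^ 3 * exp (real n * (?r - 2 / 3 * ln 2) - real n * ln 3)"
    by (simp add: exp_diff)
  \<comment> \<open>The width of the cut costs n * 3 ln 2 / n^2 \<le> 3 ln 2 in the exponent, hence
    the factor 8.\<close>
  also have "real n * (?r - 2 / 3 * ln 2) - real n * ln 3 = - gap * n + 3 * ln 2 / n"
    using n by (simp add: gap_def field_simps power2_eq_square)
  also have "(real n + 1) ^ 3 * exp (- gap * n + 3 * ln 2 / n)
      \<le> (real n + 1) ^ 3 * (exp (- gap * n) * 8)"
  proof -
    have "3 * ln 2 / real n \<le> 3 * ln 2" using n by (simp add: divide_le_eq)
    then have "exp (3 * ln 2 / real n) \<le> exp (3 * ln 2)" by simp
    also have "exp (3 * ln 2) = (8 :: real)" using exp_of_nat_mult[of 3 "ln (2::real)"] by simp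
    finally show ?thesis unfolding exp_add by (intro mult_left_mono) auto
  qed
  finally show ?thesis by (simp add: mult_ac)
qed

text \<open>At \<open>q = (2/3, 1/6, 1/6)\<close> the function \<open>4 ln 2 \<cdot> q\<^sub>c - ln q\<^sub>c\<close> takes the same value
  for all three colours, so linearising the energy there bounds the Gibbs weight below by the
  product measure \<open>q\<close> with a constant factor.\<close>

definition tilt :: "nat \<Rightarrow> real" where
  "tilt c = (if c = 1 then 2 / 3 else 1 / 6)"

lemma exp_excess_energy_ge:
  assumes x: "x \<in> configs n" and n: "n \<ge> 1"
  shows "3 ^ n * (\<Prod>v\<in>{1..n}. tilt (x v)) \<le> exp (beta_crit n * excess_energy n x)"
proof -
  define k where "k c = real (colour_count n c x)" for c
  have sum_k: "k 1 + k 2 + k 3 = real n"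
    using sum_colour_count[OF x] by (simp add: k_def)
  have pow: "tilt c ^ colour_count n c x = exp (k c * ln (tilt c))" for c
  proof -
    have "tilt c = exp (ln (tilt c))" by (simp add: tilt_def)
    then have "tilt c ^ colour_count n c x = exp (ln (tilt c)) ^ colour_count n c x" by simp
    then show ?thesis by (simp add: k_def exp_of_nat_mult)
  qed
  have ln6: "ln (6 :: real) = ln 2 + ln 3" using ln_mult[of 2 "3 :: real"] by simp
  have "3 ^ n * (\<Prod>v\<in>{1..n}. tilt (x v)) = exp (real n * ln 3) * (\<Prod>c\<in>{1, 2, 3}. exp (k c * ln (tilt c)))"
    unfolding prod_configs_colour[OF x] pow by (simp add: exp_of_nat_mult)
  also have "\<dots> = exp (real n * ln 3 + (k 1 * ln (2 / 3) + k 2 * ln (1 / 6) + k 3 * ln (1 / 6)))"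
    by (simp add: exp_add tilt_def)
  also have "\<dots> \<le> exp (beta_crit n * excess_energy n x)"
  proof -
    have "0 \<le> (k 1 - 2 / 3 * n)\<^sup>2 + (k 2 - 1 / 6 * n)\<^sup>2 + (k 3 - 1 / 6 * n)\<^sup>2" by simp
    then have lin: "n * (4 / 3 * k 1 + 1 / 3 * k 2 + 1 / 3 * k 3) - (real n)\<^sup>2 / 2 \<le> (k 1)\<^sup>2 + (k 2)\<^sup>2 + (k 3)\<^sup>2"
      by (simp add: power2_eq_square algebra_simps)
    have "real n * ln 3 + (k 1 * ln (2 / 3) + k 2 * ln (1 / 6) + k 3 * ln (1 / 6))
        = ln 2 * (k 1 - k 2 - k 3) + ln 3 * (real n - (k 1 + k 2 + k 3))"
      by (simp add: ln_div ln6 algebra_simps)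
    also have "\<dots> = ln 2 * (k 1 - k 2 - k 3)" by (simp add: sum_k del: One_nat_def)
    also have "\<dots> = 2 * ln 2 / n * (n * (4 / 3 * k 1 + 1 / 3 * k 2 + 1 / 3 * k 3) - (real n)\<^sup>2 / 2 - (real n)\<^sup>2 / 3)"
    proof -
      have "2 * ln 2 / n * (n * (4 / 3 * k 1 + 1 / 3 * k 2 + 1 / 3 * k 3) - (real n)\<^sup>2 / 2 - (real n)\<^sup>2 / 3)
        = 2 * ln 2 * (4 / 3 * k 1 + 1 / 3 * k 2 + 1 / 3 * k 3 - 5 / 6 * real n)"
        using n by (simp add: field_simps power2_eq_square)
      also have "\<dots> = ln 2 * (k 1 - k 2 - k 3)"
        unfolding sum_k[symmetric] by (simp add: algebra_simps)
      finally show ?thesis by simp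
    qed
    also have "\<dots> \<le> 2 * ln 2 / n * ((k 1)\<^sup>2 + (k 2)\<^sup>2 + (k 3)\<^sup>2 - (real n)\<^sup>2 / 3)"
      using lin by (intro mult_left_mono) auto
    also have "\<dots> = beta_crit n * excess_energy n x"
      by (simp add: beta_crit_def excess_energy_def k_def add.assoc)
    finally show ?thesis by simp
  qed
  finally show ?thesis .
qed

text \<open>A Chernoff bound: under the tilted product measure colour 1 has mean fraction 2/3, and
  discounting it by 1/2 through \<open>h\<close> makes a fraction of at most 1/2 exponentially
  unlikely.\<close>

lemma tilt_ordered_ge:
  assumes n: "n \<ge> 12"
  shows "1 / 2 \<le> (\<Sum>x\<in>ordered n 1. \<Prod>v\<in>{1..n}. tilt (x v))"
proof -
  let ?Q = "\<lambda>x. \<Prod>v\<in>{1..n}. tilt (x v)"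
  define h :: "nat \<Rightarrow> real" where "h c = (if c = 1 then 1 / 2 else 1)" for c
  have sub: "ordered n 1 \<subseteq> configs n" by (auto simp: ordered_def)
  have Q0: "0 \<le> ?Q x" for x by (intro prod_nonneg) (simp add: tilt_def)
  have "?Q x \<le> sqrt 2 ^ n * (\<Prod>v\<in>{1..n}. tilt (x v) * h (x v))" if "x \<in> configs n - ordered n 1" for x
  proof -
    have x: "x \<in> configs n" "2 * colour_count n 1 x \<le> n" using that by (auto simp: ordered_def)
    have "(\<Prod>v\<in>{1..n}. h (x v)) = (1 / 2) ^ colour_count n 1 x"
      unfolding prod_configs_colour[OF x(1)] by (simp add: h_def)
    \<comment> \<open>The square root doubles the exponent, so that 2k \<le> n applies directly,
      also for odd n.\<close>
    also have "(1 / 2 :: real) = (1 / sqrt 2)\<^sup>2" by (simp add: power_divide)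
    also have "((1 / sqrt 2)\<^sup>2) ^ colour_count n 1 x = (1 / sqrt 2) ^ (2 * colour_count n 1 x)"
      by (rule power_mult[symmetric])
    also have "\<dots> \<ge> (1 / sqrt 2) ^ n" using x(2) by (intro power_decreasing) auto
    finally have "sqrt 2 ^ n * (1 / sqrt 2) ^ n \<le> sqrt 2 ^ n * (\<Prod>v\<in>{1..n}. h (x v))"
      by (intro mult_left_mono) auto
    then have "1 \<le> sqrt 2 ^ n * (\<Prod>v\<in>{1..n}. h (x v))" by (simp flip: power_mult_distrib)
    from mult_left_mono[OF this Q0[of x]] show ?thesis by (simp add: prod.distrib mult_ac)
  qed
  then have "sum ?Q (configs n - ordered n 1)
      \<le> (\<Sum>x\<in>configs n - ordered n 1. sqrt 2 ^ n * (\<Prod>v\<in>{1..n}. tilt (x v) * h (x v)))"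
    by (rule sum_mono)
  also have "\<dots> \<le> (\<Sum>x\<in>configs n. sqrt 2 ^ n * (\<Prod>v\<in>{1..n}. tilt (x v) * h (x v)))"
    by (intro sum_mono2) (auto intro!: mult_nonneg_nonneg prod_nonneg simp: tilt_def h_def)
  also have "\<dots> = sqrt 2 ^ n * (2 / 3) ^ n"
    unfolding sum_distrib_left[symmetric] sum_configs_prod[of "\<lambda>c. tilt c * h c"]
    by (simp add: tilt_def h_def)
  also have "\<dots> = (sqrt 2 * (2 / 3)) ^ n" by (rule power_mult_distrib[symmetric])
  \<comment> \<open>The base is the square root of 8/9, and 12 is the first even exponent bringing
    its power below 1/2.\<close>
  also have "\<dots> \<le> (sqrt 2 * (2 / 3)) ^ 12"
  proof (rule power_decreasing)
    show "sqrt 2 * (2 / 3) \<le> 1"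
      by (rule power2_le_imp_le) (simp_all add: power_mult_distrib power2_eq_square)
  qed (use n in auto)
  also have "\<dots> = ((sqrt 2 * (2 / 3))\<^sup>2) ^ 6" by (simp flip: power_mult)
  also have "\<dots> = (8 / 9) ^ 6" by (simp add: power_mult_distrib power2_eq_square)
  also have "\<dots> \<le> 1 / 2" by (simp add: power_divide)
  finally have "sum ?Q (configs n - ordered n 1) \<le> 1 / 2" .
  moreover have "sum ?Q (configs n) = 1"
    unfolding sum_configs_prod[of tilt] by (simp add: tilt_def)
  moreover have "sum ?Q (configs n) = sum ?Q (configs n - ordered n 1) + sum ?Q (ordered n 1)"
    using sub by (intro sum.subset_diff) auto
  ultimately show ?thesis by linarith
qed

text \<open>The maximal rate limits the total weight to a polynomial times \<open>3 ^ n\<close>,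
  while the tilted measure places weight of order \<open>3 ^ n\<close> on the ordered phase.\<close>

lemma gibbs_ordered_ge:
  assumes n: "n \<ge> 12"
  shows "1 / (2 * (real n + 1) ^ 3) \<le> sum (gibbs n (beta_crit n)) (ordered n 1)"
proof -
  let ?E = "\<lambda>x. exp (beta_crit n * excess_energy n x)"
  have sub: "ordered n 1 \<subseteq> configs n" by (auto simp: ordered_def)
  have n1: "n \<ge> 1" using n by simp
  have "sum ?E (configs n) \<le> (real n + 1) ^ 3 * exp (real n * (ln 3 + 2 / 3 * ln 2 - 2 / 3 * ln 2))"
    by (intro sum_exp_excess_energy_le order_refl n1 rate_le_max colour_fractions) auto
  then have Z: "sum ?E (configs n) \<le> (real n + 1) ^ 3 * 3 ^ n" by (simp add: exp_of_nat_mult)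
  have Z0: "0 < sum ?E (configs n)"
    by (intro sum_pos configs_nonempty) auto
  have "3 ^ n * (1 / 2) \<le> 3 ^ n * (\<Sum>x\<in>ordered n 1. \<Prod>v\<in>{1..n}. tilt (x v))"
    using tilt_ordered_ge[OF n] by (intro mult_left_mono) auto
  also have "\<dots> \<le> sum ?E (ordered n 1)"
    unfolding sum_distrib_left using sub by (intro sum_mono exp_excess_energy_ge n1) auto
  finally have "3 ^ n * (1 / 2) / ((real n + 1) ^ 3 * 3 ^ n) \<le> sum ?E (ordered n 1) / sum ?E (configs n)"
    using Z Z0 by (intro frac_le sum_nonneg) auto
  also have "\<dots> = sum (gibbs n (beta_crit n)) (ordered n 1)"
    unfolding sum_divide_distrib using sub by (intro sum.cong refl gibbs_excess_energy[symmetric]) auto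
  finally show ?thesis by simp
qed

section \<open>The tempering and swapping chains\<close>

lemma pmf_bind_bernoulli:
  "0 \<le> p \<Longrightarrow> p \<le> 1 \<Longrightarrow>
    pmf (bernoulli_pmf p \<bind> f) y = p * pmf (f True) y + (1 - p) * pmf (f False) y"
  unfolding pmf_bind by simp

lemma mult_min_ratio: "0 < a \<Longrightarrow> a * min 1 (b / a) = min a (b :: real)"
  by (simp add: min_mult_distrib_left)

lemma configs_upd: "x \<in> configs n \<Longrightarrow> v \<in> {1..n} \<Longrightarrow> s \<in> {1, 2, 3} \<Longrightarrow> x(v := s) \<in> configs n"
  unfolding configs_def by (auto simp: PiE_iff extensional_def)

lemma metropolis_cases:
  assumes "n \<ge> 1" "y \<in> set_pmf (metropolis n \<rho> x)"
  obtains "y = x" | v s where "v \<in> {1..n}" "s \<in> {1, 2, 3}" "y = x(v := s)"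
proof -
  have "set_pmf (pmf_of_set {1..n}) = {1..n}" "set_pmf (pmf_of_set {1, 2, 3 :: nat}) = {1, 2, 3}"
    using assms(1) by (simp_all add: set_pmf_of_set)
  with assms(2) show ?thesis
    unfolding metropolis_def Let_def set_bind_pmf set_return_pmf UN_iff singleton_iff
    by (metis that)
qed

lemma metropolis_closed:
  assumes "n \<ge> 1" "x \<in> configs n"
  shows "set_pmf (metropolis n \<rho> x) \<subseteq> configs n"
  using configs_upd[OF assms(2)] assms(2) by (auto elim!: metropolis_cases[OF assms(1)] simp del: fun_upd_apply)

text \<open>The flow from x to y is \<open>min (\<rho> x) (\<rho> y)\<close> times the proposal
  probability, which is symmetric because both directions require agreement off one vertex.\<close>

lemma metropolis_balance:
  assumes n: "n \<ge> 1" and x: "x \<in> configs n" and y: "y \<in> configs n"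
    and pos: "\<And>z. z \<in> configs n \<Longrightarrow> 0 < \<rho> z"
  shows "\<rho> x * pmf (metropolis n \<rho> x) y = \<rho> y * pmf (metropolis n \<rho> y) x"
proof (cases "x = y")
  case False
  define e where "e x y = (\<Sum>v\<in>{1..n}. (\<Sum>s\<in>{1, 2, 3}. of_bool (x(v := s) = y)) / 3) / real n"
    for x y :: config
  have key: "\<rho> x * pmf (metropolis n \<rho> x) y = min (\<rho> x) (\<rho> y) * e x y"
    if x: "x \<in> configs n" and y: "y \<in> configs n" and "x \<noteq> y" for x y
  proof -
    have "pmf (metropolis n \<rho> x) y
      = (\<Sum>v\<in>{1..n}. (\<Sum>s\<in>{1, 2, 3}. min 1 (\<rho> (x(v := s)) / \<rho> x) * of_bool (x(v := s) = y)) / 3) / n"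
    proof -
      have step: "pmf (bernoulli_pmf (min 1 (\<rho> z / \<rho> x)) \<bind>
            (\<lambda>accept. return_pmf (if accept then z else x))) y
          = min 1 (\<rho> z / \<rho> x) * of_bool (z = y)" if "z \<in> configs n" for z
        using pos[OF that] pos[OF x] \<open>x \<noteq> y\<close>
        by (subst pmf_bind_bernoulli) (auto simp: indicator_def)
      show ?thesis
        unfolding metropolis_def Let_def using n
        by (subst pmf_bind_pmf_of_set, simp, simp)
          (intro arg_cong2[where f = "(/)"] sum.cong refl;
           (subst pmf_bind_pmf_of_set)?; simp add: step configs_upd[OF x])
    qed
    also have "\<dots> = (\<Sum>v\<in>{1..n}. (\<Sum>s\<in>{1, 2, 3}. min 1 (\<rho> y / \<rho> x) * of_bool (x(v := s) = y)) / 3) / n"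
      by (intro arg_cong2[where f = "(/)"] sum.cong refl) auto
    also have "\<dots> = min 1 (\<rho> y / \<rho> x) * e x y"
      unfolding e_def by (simp only: sum_distrib_left[symmetric] times_divide_eq_right[symmetric])
    finally show ?thesis using mult_min_ratio[OF pos[OF x], of "\<rho> y"] by simp
  qed
  have count: "(\<Sum>s\<in>{1, 2, 3}. of_bool (x(v := s) = y)) = (of_bool (\<forall>w. w \<noteq> v \<longrightarrow> x w = y w) :: real)"
    if "y \<in> configs n" "v \<in> {1..n}" for x y v
  proof -
    have "x(v := s) = y \<longleftrightarrow> s = y v \<and> (\<forall>w. w \<noteq> v \<longrightarrow> x w = y w)" for s
      by (auto simp: fun_eq_iff)
    then show ?thesis using configs_colour[OF that] by auto
  qed
  have "(\<Sum>s\<in>{1, 2, 3}. of_bool (x(v := s) = y)) = (\<Sum>s\<in>{1, 2, 3}. of_bool (y(v := s) = x) :: real)"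
    if v: "v \<in> {1..n}" for v
  proof -
    have "(\<forall>w. w \<noteq> v \<longrightarrow> x w = y w) = (\<forall>w. w \<noteq> v \<longrightarrow> y w = x w)" by metis
    then show ?thesis by (simp only: count[OF x v] count[OF y v])
  qed
  then have "e x y = e y x"
    unfolding e_def by (simp only: cong: sum.cong)
  then show ?thesis using key[OF x y False] key[OF y x] False by (simp add: min.commute)
qed simp

lemma ordered_disjoint:
  assumes "c \<in> {1, 2, 3}" "d \<in> {1, 2, 3}" "c \<noteq> d"
  shows "ordered n c \<inter> ordered n d = {}"
proof -
  have False if x: "x \<in> configs n" and "n < 2 * colour_count n c x" "n < 2 * colour_count n d x" for x
  proof -
    have "colour_count n 1 x + colour_count n 2 x + colour_count n 3 x = n"
      using sum_colour_count[OF x] by (simp flip: of_nat_add)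
    with that assms show False by auto
  qed
  then show ?thesis by (auto simp: ordered_def)
qed

lemma colour_count_upd_le: "colour_count n c (x(v := s)) \<le> colour_count n c x + 1"
proof -
  have "colour_count n c (x(v := s)) \<le> card (insert v {w \<in> {1..n}. x w = c})"
    unfolding colour_count_def by (intro card_mono) auto
  also have "\<dots> \<le> colour_count n c x + 1"
    unfolding colour_count_def by (rule order_trans[OF card_insert_le_m1]) auto
  finally show ?thesis .
qed

lemma colour_count_upd_ge: "colour_count n c x \<le> colour_count n c (x(v := s)) + 1"
  using colour_count_upd_le[of n c "x(v := s)" v "x v"] by simp

text \<open>A step moves a colour count k by at most 1. The phase can be left only if 2k \<le> n + 2
  and entered only if n \<le> 2k + 1, which is where the asymmetric window of
  \<open>boundary\<close> comes from.\<close>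

lemma metropolis_ordered_iff:
  assumes n: "n \<ge> 1" and x: "x \<in> configs n" "x \<notin> boundary n"
    and y: "y \<in> set_pmf (metropolis n \<rho> x)" and c: "c \<in> {1, 2, 3}"
  shows "y \<in> ordered n c \<longleftrightarrow> x \<in> ordered n c"
proof -
  have "y \<in> configs n" using metropolis_closed[OF n x(1)] y by blast
  moreover have "colour_count n c y \<le> colour_count n c x + 1 \<and> colour_count n c x \<le> colour_count n c y + 1"
    using n y by (rule metropolis_cases) (simp_all add: colour_count_upd_le[simplified] colour_count_upd_ge[simplified])
  moreover have "2 * colour_count n c x + 1 < n \<or> n + 2 < 2 * colour_count n c x"
    using x c unfolding boundary_def by (simp add: not_le) (metis not_le)
  ultimately show ?thesis using x(1) unfolding ordered_def by auto
qed

section \<open>The tempering chain and its reversibility\<close>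

locale level_distributions =
  fixes n M :: nat and \<rho> :: "nat \<Rightarrow> config \<Rightarrow> real"
  assumes n_pos: "n \<ge> 1"
    and rho_pos: "i \<le> M \<Longrightarrow> x \<in> configs n \<Longrightarrow> 0 < \<rho> i x"
    and rho_sum: "i \<le> M \<Longrightarrow> sum (\<rho> i) (configs n) = 1"
begin

lemma level_balance:
  "i \<le> M \<Longrightarrow> x \<in> configs n \<Longrightarrow> y \<in> configs n \<Longrightarrow>
    \<rho> i x * pmf (metropolis n (\<rho> i) x) y = \<rho> i y * pmf (metropolis n (\<rho> i) y) x"
  using n_pos rho_pos by (intro metropolis_balance) auto

definition temperature_move :: "config \<Rightarrow> nat \<Rightarrow> (config \<times> nat) pmf" where
  "temperature_move x i = do {
     up \<leftarrow> bernoulli_pmf (1 / 2);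
     if (up \<and> i = M) \<or> (\<not> up \<and> i = 0) then return_pmf (x, i)
     else do {
       let j = (if up then i + 1 else i - 1);
       accept \<leftarrow> bernoulli_pmf (min 1 (\<rho> j x / \<rho> i x));
       return_pmf (x, if accept then j else i)
     }
   }"

lemma pmf_tempering_chain:
  "pmf (tempering_chain n M \<rho> (x, i)) z
    = 1 / 2 * pmf (map_pmf (\<lambda>x'. (x', i)) (metropolis n (\<rho> i) x)) z + 1 / 2 * pmf (temperature_move x i) z"
  unfolding tempering_chain_def temperature_move_def prod.case
  by (subst pmf_bind_bernoulli) auto

lemma pmf_temperature_move:
  assumes x: "x \<in> configs n" and ij: "i \<le> M" "j \<le> M" and "(x, i) \<noteq> (y, j)"
  shows "pmf (temperature_move x i) (y, j)
    = (if x = y \<and> (j = i + 1 \<or> i = j + 1) then 1 / 2 * min 1 (\<rho> j x / \<rho> i x) else 0)"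
proof -
  have accept: "pmf (bernoulli_pmf (min 1 (\<rho> k x / \<rho> i x)) \<bind>
        (\<lambda>accept. return_pmf (x, if accept then k else i))) (y, j)
      = (if x = y \<and> k = j then min 1 (\<rho> j x / \<rho> i x) else 0)" if "k \<le> M" for k
    using rho_pos[OF that x] rho_pos[OF ij(1) x] assms(4)
    by (subst pmf_bind_bernoulli) (auto simp: indicator_def)
  have up: "pmf (if i = M then return_pmf (x, i) else bernoulli_pmf (min 1 (\<rho> (i + 1) x / \<rho> i x)) \<bind>
        (\<lambda>accept. return_pmf (x, if accept then i + 1 else i))) (y, j)
      = (if x = y \<and> j = i + 1 then min 1 (\<rho> j x / \<rho> i x) else 0)"
    using accept[of "i + 1"] ij assms(4) by (auto simp: indicator_def)
  have down: "pmf (if i = 0 then return_pmf (x, i) else bernoulli_pmf (min 1 (\<rho> (i - 1) x / \<rho> i x)) \<bind>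
        (\<lambda>accept. return_pmf (x, if accept then i - 1 else i))) (y, j)
      = (if x = y \<and> i = j + 1 then min 1 (\<rho> j x / \<rho> i x) else 0)"
    using accept[of "i - 1"] ij assms(4) by (auto simp: indicator_def)
  show ?thesis
    unfolding temperature_move_def Let_def
    by (subst pmf_bind_bernoulli) (use up down in \<open>auto cong: if_cong\<close>)
qed

lemma tempering_balance:
  assumes "z \<in> tempering_space n M" "w \<in> tempering_space n M"
  shows "tempering_stationary M \<rho> z * pmf (tempering_chain n M \<rho> z) w
    = tempering_stationary M \<rho> w * pmf (tempering_chain n M \<rho> w) z"
proof (cases "z = w")
  case False
  obtain x i y j where zw: "z = (x, i)" "w = (y, j)" by fastforce
  have mem: "x \<in> configs n" "i \<le> M" "y \<in> configs n" "j \<le> M"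
    using assms by (auto simp: zw tempering_space_def)
  let ?L = "\<lambda>x i. map_pmf (\<lambda>x'. (x', i)) (metropolis n (\<rho> i) x)"
  have "\<rho> i x * pmf (?L x i) (y, j) = \<rho> j y * pmf (?L y j) (x, i)"
  proof (cases "i = j")
    case True
    have "inj (\<lambda>x' :: config. (x', j))" by (auto intro: injI)
    from pmf_map_inj'[OF this] show ?thesis
      unfolding True using level_balance[of j x y] mem by simp
  next
    case False
    then have "pmf (?L x i) (y, j) = 0" "pmf (?L y j) (x, i) = 0"
      by (auto intro!: pmf_map_outside)
    then show ?thesis by simp
  qed
  moreover have "\<rho> i x * pmf (temperature_move x i) (y, j) = \<rho> j y * pmf (temperature_move y j) (x, i)"
  proof -
    have *: "\<rho> i x * pmf (temperature_move x i) (y, j)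
        = (if x = y \<and> (j = i + 1 \<or> i = j + 1) then 1 / 2 * min (\<rho> i x) (\<rho> j x) else 0)"
      if "x \<in> configs n" "i \<le> M" "j \<le> M" "(x, i) \<noteq> (y, j)" for x i y j
      using pmf_temperature_move[OF that] mult_min_ratio[OF rho_pos[OF that(2,1)], of "\<rho> j x"] by auto
    show ?thesis
      using *[of x i j y] *[of y j i x] mem False zw by (auto simp: min.commute)
  qed
  ultimately show ?thesis
    unfolding zw tempering_stationary_def prod.case pmf_tempering_chain distrib_left
    by (simp add: algebra_simps flip: add_divide_distrib)
qed simp

lemma set_temperature_move:
  assumes "i \<le> M"
  shows "set_pmf (temperature_move x i) \<subseteq> {x} \<times> {0..M}"
  using assms unfolding temperature_move_def Let_def by (auto split: if_splits)

lemma set_tempering_chain: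
  "set_pmf (tempering_chain n M \<rho> (x, i))
    \<subseteq> (\<lambda>x'. (x', i)) ` set_pmf (metropolis n (\<rho> i) x) \<union> set_pmf (temperature_move x i)"
  unfolding tempering_chain_def temperature_move_def by (auto split: if_splits)

lemma sum_tempering_stationary:
  assumes "D \<subseteq> configs n"
  shows "sum (tempering_stationary M \<rho>) (D \<times> {0..M}) = (\<Sum>i\<in>{0..M}. sum (\<rho> i) D) / (real M + 1)"
proof -
  have "sum (tempering_stationary M \<rho>) (D \<times> {0..M}) = (\<Sum>x\<in>D. \<Sum>i\<in>{0..M}. \<rho> i x / (real M + 1))"
    by (simp add: tempering_stationary_def sum.cartesian_product)
  also have "\<dots> = (\<Sum>i\<in>{0..M}. \<Sum>x\<in>D. \<rho> i x / (real M + 1))" by (rule sum.swap)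
  finally show ?thesis by (simp add: sum_divide_distrib)
qed

lemma tempering_reversible:
  "reversible_chain (tempering_space n M) (tempering_chain n M \<rho>) (tempering_stationary M \<rho>)"
proof
  show "finite (tempering_space n M)" by (simp add: tempering_space_def)
  show "set_pmf (tempering_chain n M \<rho> z) \<subseteq> tempering_space n M" if z: "z \<in> tempering_space n M" for z
  proof -
    obtain x i where "z = (x, i)" "x \<in> configs n" "i \<le> M" using z by (cases z) (auto simp: tempering_space_def)
    then show ?thesis
      using set_tempering_chain[of x i] set_temperature_move[of i x] metropolis_closed[OF n_pos, of x "\<rho> i"]
      unfolding tempering_space_def by fastforce
  qed
  show "0 \<le> tempering_stationary M \<rho> z" if "z \<in> tempering_space n M" for z
    using that rho_pos by (auto simp: tempering_space_def tempering_stationary_def less_imp_le)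
  show "sum (tempering_stationary M \<rho>) (tempering_space n M) = 1"
    unfolding tempering_space_def by (subst sum_tempering_stationary) (simp_all add: rho_sum)
qed (rule tempering_balance)

end

section \<open>Colour symmetry\<close>

definition recolour :: "nat \<Rightarrow> (nat \<Rightarrow> nat) \<Rightarrow> config \<Rightarrow> config" where
  "recolour n \<sigma> x = (\<lambda>v\<in>{1..n}. \<sigma> (x v))"

lemma transpose_colour: "c \<in> {1, 2, 3} \<Longrightarrow> d \<in> {1, 2, 3} \<Longrightarrow> Transposition.transpose (1 :: nat) c d \<in> {1, 2, 3}"
  by (auto simp: Transposition.transpose_def)

lemma recolour_configs:
  assumes "c \<in> {1, 2, 3}" "x \<in> configs n"
  shows "recolour n (Transposition.transpose 1 c) x \<in> configs n"
  using transpose_colour[OF assms(1)] configs_colour[OF assms(2)]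
  unfolding recolour_def configs_def by (intro restrict_PiE[THEN iffD2] Pi_I) blast

lemma recolour_recolour:
  assumes "x \<in> configs n"
  shows "recolour n (Transposition.transpose a c) (recolour n (Transposition.transpose a c) x) = x"
proof
  fix v
  show "recolour n (Transposition.transpose a c) (recolour n (Transposition.transpose a c) x) v = x v"
    using assms unfolding recolour_def configs_def
    by (cases "v \<in> {1..n}") (auto simp: PiE_def extensional_def)
qed

lemma colour_count_recolour:
  "colour_count n (Transposition.transpose a c d) (recolour n (Transposition.transpose a c) x) = colour_count n d x"
proof -
  have "Transposition.transpose a c y = Transposition.transpose a c d \<longleftrightarrow> y = d" for y
    by (metis transpose_involutory)
  then show ?thesis
    unfolding colour_count_def recolour_def by (intro arg_cong[where f = card]) auto
qed

lemma ordered_recolour_iff: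
  assumes "c \<in> {1, 2, 3}" "x \<in> configs n"
  shows "recolour n (Transposition.transpose 1 c) x \<in> ordered n (Transposition.transpose 1 c d) \<longleftrightarrow> x \<in> ordered n d"
  using assms recolour_configs by (simp add: ordered_def colour_count_recolour)

lemma hamiltonian_recolour: "hamiltonian n (recolour n (Transposition.transpose a c) x) = hamiltonian n x"
proof -
  have "Transposition.transpose a c y = Transposition.transpose a c d \<longleftrightarrow> y = d" for y d
    by (metis transpose_involutory)
  then show ?thesis
    unfolding hamiltonian_def recolour_def by (intro sum.cong refl) auto
qed

lemma gibbs_recolour: "gibbs n \<beta> (recolour n (Transposition.transpose a c) x) = gibbs n \<beta> x"
  by (simp add: gibbs_def hamiltonian_recolour)

lemma partition_function_pos: "0 < partition_function n \<beta>"
  unfolding partition_function_def by (intro sum_pos configs_nonempty) auto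

lemma sum_Int_conv: "finite S \<Longrightarrow> A \<subseteq> S \<Longrightarrow> sum f A = (\<Sum>x\<in>S. f x * of_bool (x \<in> A))"
  for f :: "'a \<Rightarrow> real"
  by (simp add: if_distrib sum.If_cases Int_absorb1 of_bool_def cong: if_cong)

locale symmetric_level_distributions = level_distributions +
  assumes rho_recolour:
    "i \<le> M \<Longrightarrow> x \<in> configs n \<Longrightarrow> c \<in> {1, 2, 3} \<Longrightarrow> \<rho> i (recolour n (Transposition.transpose 1 c) x) = \<rho> i x"
begin

lemma ordered_configs: "ordered n c \<subseteq> configs n"
  by (auto simp: ordered_def)

lemma boundary_configs: "boundary n \<subseteq> configs n"
  by (auto simp: boundary_def)

lemma finite_ordered: "finite (ordered n c)"
  by (rule finite_subset[OF ordered_configs]) simp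

lemma sum_rho_ordered:
  assumes "i \<le> M" "c \<in> {1, 2, 3}"
  shows "sum (\<rho> i) (ordered n c) = sum (\<rho> i) (ordered n 1)"
proof (rule sum.reindex_bij_witness[where i = "recolour n (Transposition.transpose 1 c)" and j = "recolour n (Transposition.transpose 1 c)"])
  fix x assume "x \<in> ordered n c"
  then have x: "x \<in> configs n" "x \<in> ordered n c" using ordered_configs by auto
  show "recolour n (Transposition.transpose 1 c) (recolour n (Transposition.transpose 1 c) x) = x" using x by (intro recolour_recolour)
  show "recolour n (Transposition.transpose 1 c) x \<in> ordered n 1"
    using ordered_recolour_iff[OF assms(2) x(1), of c] x(2) by simp
  show "\<rho> i (recolour n (Transposition.transpose 1 c) x) = \<rho> i x"
    using x assms by (intro rho_recolour)
next
  fix x assume "x \<in> ordered n 1"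
  then have x: "x \<in> configs n" "x \<in> ordered n 1" using ordered_configs by auto
  show "recolour n (Transposition.transpose 1 c) (recolour n (Transposition.transpose 1 c) x) = x" using x by (intro recolour_recolour)
  show "recolour n (Transposition.transpose 1 c) x \<in> ordered n c"
    using ordered_recolour_iff[OF assms(2) x(1), of 1] x(2) by simp
qed

text \<open>The three ordered phases are disjoint and have equal mass by colour symmetry.\<close>

lemma sum_rho_ordered_le:
  assumes "i \<le> M"
  shows "sum (\<rho> i) (ordered n 1) \<le> 1 / 3"
proof -
  have "(\<Sum>c\<in>{1, 2, 3}. sum (\<rho> i) (ordered n c)) = sum (\<rho> i) (\<Union>c\<in>{1, 2, 3}. ordered n c)"
    using ordered_disjoint finite_ordered by (intro sum.UNION_disjoint[symmetric]) auto
  also have "\<dots> \<le> sum (\<rho> i) (configs n)"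
    using ordered_configs rho_pos[OF assms] by (intro sum_mono2) (auto simp: less_imp_le)
  also have "\<dots> = 1" by (rule rho_sum[OF assms])
  also have "(\<Sum>c\<in>{1, 2, 3}. sum (\<rho> i) (ordered n c)) = (\<Sum>c\<in>{1 :: nat, 2, 3}. sum (\<rho> i) (ordered n 1))"
    by (rule sum.cong[OF refl]) (rule sum_rho_ordered[OF assms])
  finally show ?thesis by simp
qed

text \<open>The set is one ordered phase at all levels together, which temperature moves preserve.
  Only the top level is known to give it mass, whence the factor M + 1; the mass of the cut is an
  average over the levels and costs nothing extra.\<close>

lemma tempering_mixing_time_ge:
  assumes b: "\<And>i. i \<le> M \<Longrightarrow> sum (\<rho> i) (boundary n) \<le> b"
    and p: "0 < p" "p \<le> sum (\<rho> M) (ordered n 1)"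
    and d: "\<delta> = 9 / 2 * (real M + 1) * b / p" "0 < \<delta>" "\<delta> \<le> 1 / 20"
    and \<epsilon>: "0 < \<epsilon>" "\<epsilon> \<le> 1 / 2"
  shows "ereal (ln (1 / \<epsilon>) / (20 * \<delta>)) \<le> ereal_of_enat
    (mixing_time (tempering_space n M) (tempering_chain n M \<rho>) (tempering_stationary M \<rho>) \<epsilon>)"
proof -
  interpret reversible_chain "tempering_space n M" "tempering_chain n M \<rho>" "tempering_stationary M \<rho>"
    by (rule tempering_reversible)
  let ?A = "ordered n 1 \<times> {0..M}" and ?D = "boundary n \<times> {0..M}"
  have nonneg: "0 \<le> sum (\<rho> i) (ordered n 1)" if "i \<le> M" for i
    using ordered_configs[of 1] rho_pos[OF that] by (intro sum_nonneg) (auto simp: less_imp_le)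
  have A: "sum (tempering_stationary M \<rho>) ?A = (\<Sum>i\<in>{0..M}. sum (\<rho> i) (ordered n 1)) / (real M + 1)"
    by (rule sum_tempering_stationary[OF ordered_configs])
  have "sum (\<rho> M) (ordered n 1) \<le> (\<Sum>i\<in>{0..M}. sum (\<rho> i) (ordered n 1))"
    using nonneg by (intro member_le_sum) auto
  then have A_ge: "p / (real M + 1) \<le> sum (tempering_stationary M \<rho>) ?A"
    unfolding A using p by (intro divide_right_mono) auto
  have "(\<Sum>i\<in>{0..M}. sum (\<rho> i) (ordered n 1)) \<le> (\<Sum>i\<in>{0..M}. 1 / 3)"
    using sum_rho_ordered_le by (intro sum_mono) auto
  then have A_le: "sum (tempering_stationary M \<rho>) ?A \<le> 1 / 3"
    unfolding A by (simp add: divide_le_eq)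
  have "(\<Sum>i\<in>{0..M}. sum (\<rho> i) (boundary n)) \<le> (\<Sum>i\<in>{0..M}. b)"
    using b by (intro sum_mono) auto
  then have D_le: "sum (tempering_stationary M \<rho>) ?D \<le> b"
    unfolding sum_tempering_stationary[OF boundary_configs] by (simp add: divide_le_eq mult.commute add.commute)
  show ?thesis
  proof (rule mixing_time_ge)
    show "?A \<subseteq> tempering_space n M" "?D \<subseteq> tempering_space n M"
      using ordered_configs boundary_configs by (auto simp: tempering_space_def)
    show "0 < sum (tempering_stationary M \<rho>) ?A"
      using A_ge p(1) by (meson divide_pos_pos less_le_trans of_nat_0_le_iff add_nonneg_pos zero_less_one)
    show "set_pmf (tempering_chain n M \<rho> z) \<subseteq> ?A" if z: "z \<in> ?A - ?D" for z
    proof -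
      obtain x i where x: "z = (x, i)" "x \<in> ordered n 1" "x \<notin> boundary n" "i \<le> M"
        using z by (cases z) auto
      then have "x' \<in> ordered n 1" if "x' \<in> set_pmf (metropolis n (\<rho> i) x)" for x'
        using metropolis_ordered_iff[OF n_pos _ x(3) that, of 1] ordered_configs by blast
      then show ?thesis
        using set_tempering_chain[of x i] set_temperature_move[OF x(4), of x] x by fastforce
    qed
    \<comment> \<open>The constant 9/2 in \<delta> is fitted to the swapping chain; here it leaves a
      spare factor 3.\<close>
    have "b = 2 / 9 * (9 / 2 * m * b / p) * (p / m)" if "m > 0" for m
      using p that by simp
    from this[of "real M + 1"] have "b = 2 / 9 * \<delta> * (p / (real M + 1))"
      unfolding d(1) by simp
    also have "\<dots> \<le> 2 / 3 * \<delta> * sum (tempering_stationary M \<rho>) ?A"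
      using A_ge d(2) p by (intro mult_mono) auto
    finally show "sum (tempering_stationary M \<rho>) ?D \<le> 2 / 3 * \<delta> * sum (tempering_stationary M \<rho>) ?A"
      using D_le by linarith
  qed (use A_le d \<epsilon> in auto)
qed

section \<open>The swapping chain and its reversibility\<close>

lemma swapping_space_mem: "x \<in> swapping_space n M \<Longrightarrow> i \<le> M \<Longrightarrow> x i \<in> configs n"
  unfolding swapping_space_def by auto

lemma swapping_space_upd:
  "x \<in> swapping_space n M \<Longrightarrow> i \<le> M \<Longrightarrow> y \<in> configs n \<Longrightarrow> x(i := y) \<in> swapping_space n M"
  unfolding swapping_space_def by (auto simp: PiE_iff extensional_def)

lemma swapping_stationary_pos: "x \<in> swapping_space n M \<Longrightarrow> 0 < swapping_stationary M \<rho> x"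
  unfolding swapping_stationary_def by (intro prod_pos) (auto intro!: rho_pos swapping_space_mem)

definition level_move :: "(nat \<Rightarrow> config) \<Rightarrow> (nat \<Rightarrow> config) pmf" where
  "level_move x = do {
     i \<leftarrow> pmf_of_set {0..M};
     map_pmf (\<lambda>x'. x(i := x')) (metropolis n (\<rho> i) (x i))
   }"

definition exchange :: "nat \<Rightarrow> (nat \<Rightarrow> config) \<Rightarrow> (nat \<Rightarrow> config)" where
  "exchange i x = x(i := x (i + 1), i + 1 := x i)"

definition swap_move :: "(nat \<Rightarrow> config) \<Rightarrow> (nat \<Rightarrow> config) pmf" where
  "swap_move x = do {
     i \<leftarrow> pmf_of_set {0..<M};
     accept \<leftarrow> bernoulli_pmf
       (min 1 (\<rho> (i + 1) (x i) * \<rho> i (x (i + 1)) / (\<rho> i (x i) * \<rho> (i + 1) (x (i + 1)))));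
     return_pmf (if accept then exchange i x else x)
   }"

lemma swapping_chain_eq:
  "swapping_chain n M \<rho> x = bernoulli_pmf (1 / 2) \<bind>
     (\<lambda>level. if level then level_move x else if M = 0 then return_pmf x else swap_move x)"
  unfolding swapping_chain_def level_move_def swap_move_def exchange_def ..

text \<open>The coordinates left alone contribute a common factor, which reduces the claim to one
  Metropolis step.\<close>

lemma level_move_balance:
  assumes x: "x \<in> swapping_space n M" and y: "y \<in> swapping_space n M"
  shows "swapping_stationary M \<rho> x * pmf (level_move x) y = swapping_stationary M \<rho> y * pmf (level_move y) x"
proof -
  have *: "swapping_stationary M \<rho> x * pmf (map_pmf (\<lambda>x'. x(i := x')) (metropolis n (\<rho> i) (x i))) y
      = swapping_stationary M \<rho> y * pmf (map_pmf (\<lambda>x'. y(i := x')) (metropolis n (\<rho> i) (y i))) x"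
    if i: "i \<in> {0..M}" for i
  proof (cases "\<forall>j. j \<noteq> i \<longrightarrow> x j = y j")
    case True
    have inj: "inj (\<lambda>x' :: config. z(i := x'))" for z
      by (intro injI) (metis fun_upd_same)
    have xy: "y = x(i := y i)" "x = y(i := x i)" using True by (auto simp: fun_eq_iff)
    define C where "C = (\<Prod>j\<in>{0..M} - {i}. \<rho> j (x j))"
    have "C = (\<Prod>j\<in>{0..M} - {i}. \<rho> j (y j))"
      unfolding C_def using True by (intro prod.cong) auto
    then have st: "swapping_stationary M \<rho> x = \<rho> i (x i) * C" "swapping_stationary M \<rho> y = \<rho> i (y i) * C"
      using i by (simp_all only: swapping_stationary_def C_def prod.remove finite_atLeastAtMost)
    have "pmf (map_pmf (\<lambda>x'. x(i := x')) (metropolis n (\<rho> i) (x i))) y = pmf (metropolis n (\<rho> i) (x i)) (y i)"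
      by (subst xy(1)) (rule pmf_map_inj'[OF inj])
    moreover have "pmf (map_pmf (\<lambda>x'. y(i := x')) (metropolis n (\<rho> i) (y i))) x = pmf (metropolis n (\<rho> i) (y i)) (x i)"
      by (subst xy(2)) (rule pmf_map_inj'[OF inj])
    moreover have "\<rho> i (x i) * pmf (metropolis n (\<rho> i) (x i)) (y i) = \<rho> i (y i) * pmf (metropolis n (\<rho> i) (y i)) (x i)"
      using i x y by (intro level_balance swapping_space_mem) auto
    ultimately show ?thesis unfolding st by (simp add: mult_ac)
  next
    case False
    then have "pmf (map_pmf (\<lambda>x'. x(i := x')) (metropolis n (\<rho> i) (x i))) y = 0"
      "pmf (map_pmf (\<lambda>x'. y(i := x')) (metropolis n (\<rho> i) (y i))) x = 0"
      by (auto intro!: pmf_map_outside simp: fun_eq_iff)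
    then show ?thesis by simp
  qed
  show ?thesis
    unfolding level_move_def
    by (simp add: pmf_bind_pmf_of_set sum_distrib_left * del: atLeastAtMost_iff cong: sum.cong)
qed

lemma exchange_exchange: "exchange i (exchange i x) = x"
  by (auto simp: exchange_def fun_eq_iff)

lemma exchange_space:
  assumes "x \<in> swapping_space n M" "i < M"
  shows "exchange i x \<in> swapping_space n M"
  unfolding exchange_def using assms by (intro swapping_space_upd swapping_space_mem) auto

text \<open>The acceptance ratio of a swap is the Metropolis ratio of the product measure.\<close>

lemma swapping_stationary_exchange:
  assumes x: "x \<in> swapping_space n M" and i: "i < M"
  shows "\<rho> (i + 1) (x i) * \<rho> i (x (i + 1)) / (\<rho> i (x i) * \<rho> (i + 1) (x (i + 1)))
    = swapping_stationary M \<rho> (exchange i x) / swapping_stationary M \<rho> x"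
proof -
  have split: "swapping_stationary M \<rho> z
      = \<rho> i (z i) * \<rho> (i + 1) (z (i + 1)) * (\<Prod>j\<in>{0..M} - {i} - {i + 1}. \<rho> j (z j))" for z
    unfolding swapping_stationary_def using i
    by (subst prod.remove[of _ i], simp, simp, subst prod.remove[of _ "i + 1"]) auto
  have C: "(\<Prod>j\<in>{0..M} - {i} - {i + 1}. \<rho> j (exchange i x j)) = (\<Prod>j\<in>{0..M} - {i} - {i + 1}. \<rho> j (x j))"
    by (intro prod.cong) (auto simp: exchange_def)
  have "(\<Prod>j\<in>{0..M} - {i} - {i + 1}. \<rho> j (x j)) \<noteq> 0"
    using swapping_stationary_pos[OF x] unfolding split by (metis less_irrefl mult_zero_right)
  then show ?thesis
    unfolding split C by (simp add: exchange_def mult.commute)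
qed

lemma swap_move_balance:
  assumes x: "x \<in> swapping_space n M" and y: "y \<in> swapping_space n M" and "x \<noteq> y" "M > 0"
  shows "swapping_stationary M \<rho> x * pmf (swap_move x) y = swapping_stationary M \<rho> y * pmf (swap_move y) x"
proof -
  let ?\<pi> = "swapping_stationary M \<rho>"
  have key: "?\<pi> x * pmf (swap_move x) y = (\<Sum>i\<in>{0..<M}. min (?\<pi> x) (?\<pi> y) * of_bool (exchange i x = y)) / M"
    if x: "x \<in> swapping_space n M" and "x \<noteq> y" for x y
  proof -
    have step: "?\<pi> x * pmf (bernoulli_pmf (min 1 (\<rho> (i + 1) (x i) * \<rho> i (x (i + 1)) / (\<rho> i (x i) * \<rho> (i + 1) (x (i + 1)))))
          \<bind> (\<lambda>accept. return_pmf (if accept then exchange i x else x))) y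
        = min (?\<pi> x) (?\<pi> y) * of_bool (exchange i x = y)" if "i \<in> {0..<M}" for i
    proof -
      have i: "i < M" using that by simp
      have pos: "0 < ?\<pi> x" "0 < ?\<pi> (exchange i x)"
        using exchange_space[OF x i] x by (auto intro: swapping_stationary_pos)
      then show ?thesis
        unfolding swapping_stationary_exchange[OF x i]
        using mult_min_ratio[OF pos(1), of "?\<pi> (exchange i x)"] \<open>x \<noteq> y\<close>
        by (subst pmf_bind_bernoulli) (auto simp: indicator_def)
    qed
    have "?\<pi> x * pmf (swap_move x) y = (\<Sum>i\<in>{0..<M}. ?\<pi> x * pmf (bernoulli_pmf (min 1 (\<rho> (i + 1) (x i) * \<rho> i (x (i + 1)) / (\<rho> i (x i) * \<rho> (i + 1) (x (i + 1)))))
          \<bind> (\<lambda>accept. return_pmf (if accept then exchange i x else x))) y) / M"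
      unfolding swap_move_def using \<open>M > 0\<close>
      by (subst pmf_bind_pmf_of_set) (simp_all add: sum_distrib_left)
    also have "\<dots> = (\<Sum>i\<in>{0..<M}. min (?\<pi> x) (?\<pi> y) * of_bool (exchange i x = y)) / M"
      by (simp only: step cong: sum.cong)
    finally show ?thesis .
  qed
  have "exchange i x = y \<longleftrightarrow> exchange i y = x" for i
    using exchange_exchange by metis
  then show ?thesis
    using key[OF x, of y] key[OF y, of x] \<open>x \<noteq> y\<close> by (simp add: min.commute)
qed

lemma level_move_cases:
  assumes "y \<in> set_pmf (level_move x)"
  obtains i z where "i \<le> M" "z \<in> set_pmf (metropolis n (\<rho> i) (x i))" "y = x(i := z)"
  using assms that unfolding level_move_def by (auto simp: set_pmf_of_set)

lemma swap_move_cases: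
  assumes "y \<in> set_pmf (swap_move x)" "M > 0"
  obtains "y = x" | i where "i < M" "y = exchange i x"
  using assms that unfolding swap_move_def by (auto simp: set_pmf_of_set split: if_splits)

lemma swapping_chain_cases:
  assumes "y \<in> set_pmf (swapping_chain n M \<rho> x)"
  obtains "y = x" | i z where "i \<le> M" "z \<in> set_pmf (metropolis n (\<rho> i) (x i))" "y = x(i := z)"
  | i where "i < M" "y = exchange i x"
proof -
  have "y \<in> set_pmf (level_move x) \<or> y = x \<or> (M > 0 \<and> y \<in> set_pmf (swap_move x))"
    using assms unfolding swapping_chain_eq by (auto split: if_splits)
  then show ?thesis
    using that by (elim disjE conjE level_move_cases swap_move_cases) auto
qed

lemma sum_prod_swapping_space:
  "(\<Sum>x\<in>swapping_space n M. \<Prod>i\<in>{0..M}. f i (x i)) = (\<Prod>i\<in>{0..M}. \<Sum>z\<in>configs n. f i z)"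
  for f :: "nat \<Rightarrow> config \<Rightarrow> real"
  unfolding swapping_space_def by (rule prod_sum_PiE[symmetric]) auto

lemma finite_swapping_space: "finite (swapping_space n M)"
  unfolding swapping_space_def by (intro finite_PiE) auto

lemma sum_swapping_stationary: "sum (swapping_stationary M \<rho>) (swapping_space n M) = 1"
  unfolding swapping_stationary_def sum_prod_swapping_space by (simp add: rho_sum)

lemma swapping_reversible:
  "reversible_chain (swapping_space n M) (swapping_chain n M \<rho>) (swapping_stationary M \<rho>)"
proof
  show "finite (swapping_space n M)" by (rule finite_swapping_space)
  show "sum (swapping_stationary M \<rho>) (swapping_space n M) = 1" by (rule sum_swapping_stationary)
  fix x assume x: "x \<in> swapping_space n M"
  show "0 \<le> swapping_stationary M \<rho> x" using swapping_stationary_pos[OF x] by simp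
  show "set_pmf (swapping_chain n M \<rho> x) \<subseteq> swapping_space n M"
  proof
    fix y assume "y \<in> set_pmf (swapping_chain n M \<rho> x)"
    then show "y \<in> swapping_space n M"
    proof (cases rule: swapping_chain_cases)
      case (2 i z)
      then show ?thesis
        using metropolis_closed[OF n_pos swapping_space_mem[OF x 2(1)], of "\<rho> i"] swapping_space_upd[OF x] by blast
    qed (use x exchange_space in auto)
  qed
  fix y assume y: "y \<in> swapping_space n M"
  show "swapping_stationary M \<rho> x * pmf (swapping_chain n M \<rho> x) y
      = swapping_stationary M \<rho> y * pmf (swapping_chain n M \<rho> y) x"
  proof (cases "x = y")
    case False
    have "swapping_stationary M \<rho> x * pmf (if M = 0 then return_pmf x else swap_move x) y
      = swapping_stationary M \<rho> y * pmf (if M = 0 then return_pmf y else swap_move y) x"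
      using swap_move_balance[OF x y False] False by simp
    with level_move_balance[OF x y] show ?thesis
      unfolding swapping_chain_eq
      by (subst (1 2) pmf_bind_bernoulli) (simp_all add: distrib_left mult.left_commute)
  qed simp
qed

end

context symmetric_level_distributions
begin

definition ordered_levels :: "nat \<Rightarrow> (nat \<Rightarrow> config) \<Rightarrow> nat" where
  "ordered_levels c x = card {i \<in> {0..M}. x i \<in> ordered n c}"

text \<open>Counting the ordered levels of each colour is invariant under swaps. Requiring one colour to
  be ahead of both others keeps the stationary probability at most \<open>1/3\<close>.\<close>

definition leading :: "nat \<Rightarrow> (nat \<Rightarrow> config) set" where
  "leading c = {x \<in> swapping_space n M. \<forall>d\<in>{1, 2, 3} - {c}. ordered_levels d x < ordered_levels c x}"

definition boundary_tuples :: "(nat \<Rightarrow> config) set" where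
  "boundary_tuples = {x \<in> swapping_space n M. \<exists>i\<in>{0..M}. x i \<in> boundary n}"

lemma leading_space: "leading c \<subseteq> swapping_space n M"
  by (auto simp: leading_def)

lemma ordered_levels_exchange:
  assumes "i < M"
  shows "ordered_levels c (exchange i x) = ordered_levels c x"
proof -
  let ?\<tau> = "Transposition.transpose i (i + 1)"
  have ex: "exchange i x j = x (?\<tau> j)" for j
    by (auto simp: exchange_def Transposition.transpose_def)
  have \<tau>: "?\<tau> j \<in> {0..M} \<longleftrightarrow> j \<in> {0..M}" for j
    using assms by (auto simp: Transposition.transpose_def)
  have "{j \<in> {0..M}. exchange i x j \<in> ordered n c} = ?\<tau> ` {j \<in> {0..M}. x j \<in> ordered n c}"
  proof (intro equalityI subsetI)
    fix j assume "j \<in> {j \<in> {0..M}. exchange i x j \<in> ordered n c}"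
    then have "?\<tau> j \<in> {j \<in> {0..M}. x j \<in> ordered n c}" using \<tau>[of j] by (simp add: ex)
    then show "j \<in> ?\<tau> ` {j \<in> {0..M}. x j \<in> ordered n c}"
      by (metis imageI transpose_involutory)
  next
    fix j assume "j \<in> ?\<tau> ` {j \<in> {0..M}. x j \<in> ordered n c}"
    then obtain k where "j = ?\<tau> k" "k \<in> {0..M}" "x k \<in> ordered n c" by blast
    then show "j \<in> {j \<in> {0..M}. exchange i x j \<in> ordered n c}"
      using \<tau>[of k] by (simp add: ex)
  qed
  then show ?thesis
    unfolding ordered_levels_def by (simp add: card_image)
qed

text \<open>Off the cut no level changes its phase, so all three counts are constant. A lead can be
  lost both by a level leaving colour c and by one entering another colour, so the cut must be
  two-sided and cover every colour.\<close>

lemma leading_stay: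
  assumes x: "x \<in> leading c - boundary_tuples" and c: "c \<in> {1, 2, 3}"
  shows "set_pmf (swapping_chain n M \<rho> x) \<subseteq> leading c"
proof
  interpret reversible_chain "swapping_space n M" "swapping_chain n M \<rho>" "swapping_stationary M \<rho>"
    by (rule swapping_reversible)
  fix y assume y: "y \<in> set_pmf (swapping_chain n M \<rho> x)"
  have xs: "x \<in> swapping_space n M" using x leading_space by blast
  have "ordered_levels d y = ordered_levels d x" if d: "d \<in> {1, 2, 3}" for d
    using y
  proof (cases rule: swapping_chain_cases)
    case (2 i z)
    have xi: "x i \<in> configs n" "x i \<notin> boundary n"
      using swapping_space_mem[OF xs 2(1)] x xs 2(1) by (auto simp: boundary_tuples_def)
    have "z \<in> ordered n d \<longleftrightarrow> x i \<in> ordered n d"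
      by (rule metropolis_ordered_iff[OF n_pos xi 2(2) d])
    then have "{j \<in> {0..M}. y j \<in> ordered n d} = {j \<in> {0..M}. x j \<in> ordered n d}"
      unfolding 2(3) by auto
    then show ?thesis by (simp add: ordered_levels_def)
  qed (simp_all add: ordered_levels_exchange)
  moreover have "y \<in> swapping_space n M" using kernel_closed[OF xs] y by blast
  ultimately show "y \<in> leading c" using x c by (auto simp: leading_def)
qed

text \<open>A union bound over the levels, each marginal of the product measure being the law of its
  level.\<close>

lemma sum_boundary_tuples_le:
  assumes b: "\<And>i. i \<le> M \<Longrightarrow> sum (\<rho> i) (boundary n) \<le> b"
  shows "sum (swapping_stationary M \<rho>) boundary_tuples \<le> (real M + 1) * b"
proof -
  let ?\<pi> = "swapping_stationary M \<rho>"
  have nonneg: "0 \<le> ?\<pi> x" if "x \<in> swapping_space n M" for x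
    using swapping_stationary_pos[OF that] by simp
  have marginal: "(\<Sum>x\<in>swapping_space n M. ?\<pi> x * of_bool (x i \<in> boundary n)) = sum (\<rho> i) (boundary n)"
    if i: "i \<in> {0..M}" for i
  proof -
    define g :: "nat \<Rightarrow> config \<Rightarrow> real" where
      "g j z = \<rho> j z * (if j = i then of_bool (z \<in> boundary n) else 1)" for j z
    have "?\<pi> x * of_bool (x i \<in> boundary n) = (\<Prod>j\<in>{0..M}. g j (x j))" for x
      using i by (simp add: swapping_stationary_def g_def prod.distrib)
    then have "(\<Sum>x\<in>swapping_space n M. ?\<pi> x * of_bool (x i \<in> boundary n))
        = (\<Prod>j\<in>{0..M}. \<Sum>z\<in>configs n. g j z)"
      by (simp only: sum_prod_swapping_space)
    also have "\<dots> = (\<Sum>z\<in>configs n. g i z) * (\<Prod>j\<in>{0..M} - {i}. \<Sum>z\<in>configs n. g j z)"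
      using i by (intro prod.remove) auto
    also have "(\<Prod>j\<in>{0..M} - {i}. \<Sum>z\<in>configs n. g j z) = 1"
      by (intro prod.neutral) (simp add: g_def rho_sum)
    also have "(\<Sum>z\<in>configs n. g i z) = sum (\<rho> i) (boundary n)"
      unfolding g_def sum_Int_conv[OF finite_configs boundary_configs] by simp
    finally show ?thesis by simp
  qed
  have "sum ?\<pi> boundary_tuples = (\<Sum>x\<in>swapping_space n M. ?\<pi> x * of_bool (x \<in> boundary_tuples))"
    by (rule sum_Int_conv[OF finite_swapping_space]) (auto simp: boundary_tuples_def)
  also have "\<dots> \<le> (\<Sum>x\<in>swapping_space n M. \<Sum>i\<in>{0..M}. ?\<pi> x * of_bool (x i \<in> boundary n))"
  proof (intro sum_mono)
    fix x assume x: "x \<in> swapping_space n M"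
    show "?\<pi> x * of_bool (x \<in> boundary_tuples) \<le> (\<Sum>i\<in>{0..M}. ?\<pi> x * of_bool (x i \<in> boundary n))"
    proof (cases "x \<in> boundary_tuples")
      case True
      then obtain i where i: "i \<in> {0..M}" "x i \<in> boundary n" by (auto simp: boundary_tuples_def)
      then have "?\<pi> x * of_bool (x i \<in> boundary n) \<le> (\<Sum>i\<in>{0..M}. ?\<pi> x * of_bool (x i \<in> boundary n))"
        using nonneg[OF x] by (intro member_le_sum) auto
      moreover have "of_bool (x i \<in> boundary n) = (of_bool (x \<in> boundary_tuples) :: real)"
        using i True by simp
      ultimately show ?thesis by (simp only:)
    qed (use nonneg[OF x] in \<open>simp add: sum_nonneg\<close>)
  qed
  also have "\<dots> = (\<Sum>i\<in>{0..M}. \<Sum>x\<in>swapping_space n M. ?\<pi> x * of_bool (x i \<in> boundary n))"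
    by (rule sum.swap)
  also have "\<dots> \<le> (\<Sum>i\<in>{0..M}. b)"
    using b by (intro sum_mono) (simp only: marginal, simp)
  finally show ?thesis by (simp add: add.commute)
qed

text \<open>Recolouring all levels at once is an involution that preserves the weights and permutes
  the leading colours.\<close>

lemma sum_leading_eq:
  assumes c: "c \<in> {1, 2, 3}"
  shows "sum (swapping_stationary M \<rho>) (leading c) = sum (swapping_stationary M \<rho>) (leading 1)"
proof -
  let ?\<tau> = "Transposition.transpose 1 c"
  define F where "F x = (\<lambda>i\<in>{0..M}. recolour n ?\<tau> (x i))" for x :: "nat \<Rightarrow> config"
  have space: "F x \<in> swapping_space n M" if "x \<in> swapping_space n M" for x
    using recolour_configs[OF c] swapping_space_mem[OF that] unfolding F_def swapping_space_def by auto
  have FF: "F (F x) = x" if "x \<in> swapping_space n M" for x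
  proof
    fix i show "F (F x) i = x i"
    proof (cases "i \<in> {0..M}")
      case True
      then show ?thesis using recolour_recolour[OF swapping_space_mem[OF that]] by (simp add: F_def)
    next
      case False
      then show ?thesis using that unfolding F_def swapping_space_def by (auto simp: PiE_def extensional_def)
    qed
  qed
  have lev: "ordered_levels (?\<tau> d) (F x) = ordered_levels d x" if "x \<in> swapping_space n M" for x d
  proof -
    have "{i \<in> {0..M}. F x i \<in> ordered n (?\<tau> d)} = {i \<in> {0..M}. x i \<in> ordered n d}"
      using ordered_recolour_iff[OF c swapping_space_mem[OF that]] by (auto simp: F_def)
    then show ?thesis by (simp add: ordered_levels_def)
  qed
  have lead: "F x \<in> leading (?\<tau> d)" if "x \<in> leading d" "d \<in> {1, 2, 3}" for x d
  proof -
    have x: "x \<in> swapping_space n M" using that leading_space by blast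
    have "ordered_levels e (F x) < ordered_levels (?\<tau> d) (F x)" if e: "e \<in> {1, 2, 3} - {?\<tau> d}" for e
    proof -
      have "?\<tau> e \<in> {1, 2, 3}" using transpose_colour[OF c] e by blast
      moreover have "?\<tau> e \<noteq> d" using e by (auto simp: transpose_eq_iff)
      ultimately have "ordered_levels (?\<tau> e) x < ordered_levels d x"
        using \<open>x \<in> leading d\<close> by (auto simp: leading_def)
      then show ?thesis using lev[OF x, of "?\<tau> e"] lev[OF x, of d] by simp
    qed
    then show ?thesis using space[OF x] by (simp add: leading_def)
  qed
  show ?thesis
  proof (rule sum.reindex_bij_witness[where i = F and j = F])
    fix x assume x: "x \<in> leading c"
    then have xs: "x \<in> swapping_space n M" using leading_space by blast
    show "F (F x) = x" by (rule FF[OF xs])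
    show "F x \<in> leading 1" using lead[OF x c] by simp
    show "swapping_stationary M \<rho> (F x) = swapping_stationary M \<rho> x"
      unfolding swapping_stationary_def
      by (intro prod.cong refl) (simp add: F_def rho_recolour[OF _ swapping_space_mem[OF xs] c] del: One_nat_def)
  next
    fix x assume x: "x \<in> leading 1"
    then have xs: "x \<in> swapping_space n M" using leading_space by blast
    show "F (F x) = x" by (rule FF[OF xs])
    show "F x \<in> leading c" using lead[OF x] by simp
  qed
qed

lemma leading_disjoint:
  assumes "c \<in> {1, 2, 3}" "d \<in> {1, 2, 3}" "c \<noteq> d"
  shows "leading c \<inter> leading d = {}"
proof -
  have mem: "d \<in> {1, 2, 3} - {c}" "c \<in> {1, 2, 3} - {d}"
    using assms by (metis Diff_iff singletonD)+
  have False if x: "x \<in> leading c" "x \<in> leading d" for x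
  proof -
    have "ordered_levels d x < ordered_levels c x"
      using x(1) unfolding leading_def mem_Collect_eq by (elim conjE bspec[OF _ mem(1)])
    moreover have "ordered_levels c x < ordered_levels d x"
      using x(2) unfolding leading_def mem_Collect_eq by (elim conjE bspec[OF _ mem(2)])
    ultimately show False by simp
  qed
  then show ?thesis by blast
qed

lemma sum_leading: "sum (swapping_stationary M \<rho>) (\<Union>c\<in>{1, 2, 3}. leading c)
    = 3 * sum (swapping_stationary M \<rho>) (leading 1)"
proof -
  have "finite (leading c)" for c
    using finite_subset[OF leading_space finite_swapping_space] .
  then have "sum (swapping_stationary M \<rho>) (\<Union>c\<in>{1, 2, 3}. leading c)
      = (\<Sum>c\<in>{1, 2, 3}. sum (swapping_stationary M \<rho>) (leading c))"
    using leading_disjoint by (intro sum.UNION_disjoint) auto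
  also have "\<dots> = (\<Sum>c\<in>{1 :: nat, 2, 3}. sum (swapping_stationary M \<rho>) (leading 1))"
    by (rule sum.cong[OF refl]) (rule sum_leading_eq)
  finally show ?thesis by simp
qed

text \<open>Whatever the lower levels are, some colour is (perhaps not strictly) ahead on them, and it
  becomes strictly ahead when the top level is ordered in that colour.\<close>

lemma sum_leading_ge:
  "sum (\<rho> M) (ordered n 1) \<le> sum (swapping_stationary M \<rho>) (\<Union>c\<in>{1, 2, 3}. leading c)"
proof -
  let ?U = "\<Union>c\<in>{1, 2, 3}. leading c"
  let ?Y = "{0..<M} \<rightarrow>\<^sub>E configs n"
  define w where "w y = (\<Prod>i\<in>{0..<M}. \<rho> i (y i))" for y :: "nat \<Rightarrow> config"
  define k where "k c y = card {i \<in> {0..<M}. y i \<in> ordered n c}" for c and y :: "nat \<Rightarrow> config"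
  have M: "{0..M} = insert M {0..<M}" by auto
  have space: "swapping_space n M = (\<lambda>(z, y). y(M := z)) ` (configs n \<times> ?Y)"
    unfolding swapping_space_def M by (rule PiE_insert_eq)
  have stat: "swapping_stationary M \<rho> (y(M := z)) = \<rho> M z * w y" for y z
  proof -
    have "(\<Prod>i\<in>{0..<M}. \<rho> i ((y(M := z)) i)) = w y"
      unfolding w_def by (intro prod.cong) auto
    then show ?thesis unfolding swapping_stationary_def M by simp
  qed
  have lev: "ordered_levels c (y(M := z)) = k c y + of_bool (z \<in> ordered n c)" for c y z
  proof -
    have "{i \<in> {0..M}. (y(M := z)) i \<in> ordered n c}
        = (if z \<in> ordered n c then insert M {i \<in> {0..<M}. y i \<in> ordered n c} else {i \<in> {0..<M}. y i \<in> ordered n c})"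
      by auto
    then show ?thesis unfolding ordered_levels_def k_def by simp
  qed
  have ge: "sum (\<rho> M) (ordered n 1) \<le> (\<Sum>z\<in>configs n. \<rho> M z * of_bool (y(M := z) \<in> ?U))" if y: "y \<in> ?Y" for y
  proof -
    obtain c where c: "c \<in> {1, 2, 3}" "\<And>d. d \<in> {1, 2, 3} \<Longrightarrow> k d y \<le> k c y"
    proof -
      have "Max ((\<lambda>c. k c y) ` {1, 2, 3}) \<in> (\<lambda>c. k c y) ` {1, 2, 3}" by (intro Max_in) auto
      then obtain c where "c \<in> {1, 2, 3}" "Max ((\<lambda>c. k c y) ` {1, 2, 3}) = k c y" by blast
      moreover have "k d y \<le> Max ((\<lambda>c. k c y) ` {1, 2, 3})" if "d \<in> {1, 2, 3}" for d
        using that by (intro Max_ge) auto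
      ultimately show ?thesis using that by metis
    qed
    have "y(M := z) \<in> ?U" if z: "z \<in> ordered n c" for z
    proof -
      have "z \<notin> ordered n d" if "d \<in> {1, 2, 3} - {c}" for d
        using ordered_disjoint[of c d n] c(1) that z by blast
      then have "ordered_levels d (y(M := z)) < ordered_levels c (y(M := z))" if "d \<in> {1, 2, 3} - {c}" for d
        unfolding lev using c(2)[of d] that z by auto
      moreover have "z \<in> configs n" using z ordered_configs by blast
      then have "y(M := z) \<in> swapping_space n M" unfolding space using y by (intro image_eqI[of _ _ "(z, y)"]) auto
      ultimately have "y(M := z) \<in> leading c" unfolding leading_def by blast
      then show ?thesis using c(1) by blast
    qed
    then have "(\<Sum>z\<in>configs n. \<rho> M z * of_bool (z \<in> ordered n c)) \<le> (\<Sum>z\<in>configs n. \<rho> M z * of_bool (y(M := z) \<in> ?U))"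
      using rho_pos[of M] by (intro sum_mono mult_left_mono) (auto simp: less_imp_le)
    then show ?thesis
      unfolding sum_Int_conv[OF finite_configs ordered_configs, symmetric] sum_rho_ordered[OF order_refl c(1)] .
  qed
  have w: "sum w ?Y = 1"
    unfolding w_def using rho_sum by (subst prod_sum_PiE[symmetric]) auto
  have w0: "0 \<le> w y" if "y \<in> ?Y" for y
    unfolding w_def using that by (intro prod_nonneg) (auto intro!: less_imp_le rho_pos)
  have "sum (\<rho> M) (ordered n 1) = (\<Sum>y\<in>?Y. w y * sum (\<rho> M) (ordered n 1))"
    using w by (simp flip: sum_distrib_right)
  also have "\<dots> \<le> (\<Sum>y\<in>?Y. w y * (\<Sum>z\<in>configs n. \<rho> M z * of_bool (y(M := z) \<in> ?U)))"
    using ge w0 by (intro sum_mono mult_left_mono) auto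
  also have "\<dots> = (\<Sum>y\<in>?Y. \<Sum>z\<in>configs n. swapping_stationary M \<rho> (y(M := z)) * of_bool (y(M := z) \<in> ?U))"
    unfolding stat sum_distrib_left by (intro sum.cong refl) (simp only: mult_ac)
  also have "\<dots> = (\<Sum>z\<in>configs n. \<Sum>y\<in>?Y. swapping_stationary M \<rho> (y(M := z)) * of_bool (y(M := z) \<in> ?U))"
    by (rule sum.swap)
  also have "\<dots> = (\<Sum>(z, y)\<in>configs n \<times> ?Y. swapping_stationary M \<rho> (y(M := z)) * of_bool (y(M := z) \<in> ?U))"
    by (rule sum.cartesian_product)
  also have "\<dots> = (\<Sum>x\<in>swapping_space n M. swapping_stationary M \<rho> x * of_bool (x \<in> ?U))"
    unfolding space using inj_combinator[of M "{0..<M}" "\<lambda>_. configs n"]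
    by (subst sum.reindex) (auto simp: case_prod_unfold intro!: sum.cong)
  also have "\<dots> = sum (swapping_stationary M \<rho>) ?U"
    using leading_space by (intro sum_Int_conv[OF finite_swapping_space, symmetric]) blast
  finally show ?thesis .
qed

text \<open>Compared with tempering the losses change places: M + 1 is now paid by the cut, through
  the union bound, whereas the set retains a third of the mass p guaranteed by the top level. With
  2/3 from 1 - \<pi>(A) this makes the constant 9/2.\<close>

lemma swapping_mixing_time_ge:
  assumes b: "\<And>i. i \<le> M \<Longrightarrow> sum (\<rho> i) (boundary n) \<le> b"
    and p: "0 < p" "p \<le> sum (\<rho> M) (ordered n 1)"
    and d: "\<delta> = 9 / 2 * (real M + 1) * b / p" "0 < \<delta>" "\<delta> \<le> 1 / 20"
    and \<epsilon>: "0 < \<epsilon>" "\<epsilon> \<le> 1 / 2"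
  shows "ereal (ln (1 / \<epsilon>) / (20 * \<delta>)) \<le> ereal_of_enat
    (mixing_time (swapping_space n M) (swapping_chain n M \<rho>) (swapping_stationary M \<rho>) \<epsilon>)"
proof -
  interpret reversible_chain "swapping_space n M" "swapping_chain n M \<rho>" "swapping_stationary M \<rho>"
    by (rule swapping_reversible)
  let ?\<pi> = "swapping_stationary M \<rho>"
  have A_ge: "p / 3 \<le> sum ?\<pi> (leading 1)"
    using p sum_leading_ge sum_leading by simp
  have "sum ?\<pi> (\<Union>c\<in>{1, 2, 3}. leading c) \<le> sum ?\<pi> (swapping_space n M)"
    using leading_space pi_nonneg by (intro sum_mono2 finite_space) blast+
  then have A_le: "sum ?\<pi> (leading 1) \<le> 1 / 3"
    unfolding sum_leading pi_sum by simp
  show ?thesis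
  proof (rule mixing_time_ge)
    show "leading 1 \<subseteq> swapping_space n M" by (rule leading_space)
    show "boundary_tuples \<subseteq> swapping_space n M" by (auto simp: boundary_tuples_def)
    show "set_pmf (swapping_chain n M \<rho> x) \<subseteq> leading 1" if "x \<in> leading 1 - boundary_tuples" for x
      using that by (rule leading_stay) simp
    show "0 < sum ?\<pi> (leading 1)" using A_ge p(1) by linarith
    have "sum ?\<pi> boundary_tuples \<le> (real M + 1) * b" using b by (rule sum_boundary_tuples_le)
    also have "\<dots> = 2 / 3 * \<delta> * (p / 3)" using p by (simp add: d(1))
    also have "\<dots> \<le> 2 / 3 * \<delta> * sum ?\<pi> (leading 1)"
      using A_ge d(2) by (intro mult_left_mono) auto
    finally show "sum ?\<pi> boundary_tuples \<le> 2 / 3 * \<delta> * sum ?\<pi> (leading 1)" .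
  qed (use A_le d \<epsilon> in auto)
qed

end

section \<open>Asymptotics and conclusion\<close>

lemma gibbs_symmetric_level_distributions:
  assumes "n \<ge> 1"
  shows "symmetric_level_distributions n M (\<lambda>i. gibbs n (\<beta> i))"
proof
  show "sum (gibbs n (\<beta> i)) (configs n) = 1" for i
    using partition_function_pos[of n "\<beta> i"]
    by (simp add: gibbs_def partition_function_def flip: sum_divide_distrib)
qed (use assms in \<open>simp_all add: gibbs_recolour\<close>, simp add: gibbs_def partition_function_pos)

text \<open>The left side is 20\<delta> with the bounds for cut and ordered phase inserted. Half of
  the exponent absorbs the polynomial of degree k + 6; the other half is the final rate.\<close>

lemma eventually_conductance_le:
  assumes "(\<lambda>n. real (M n)) \<in> O(\<lambda>n. real n ^ k)"
  shows "\<forall>\<^sub>F n in sequentially.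
    20 * (9 / 2 * (real (M n) + 1) * (8 * (real n + 1) ^ 3 * exp (- gap * n)) / (1 / (2 * (real n + 1) ^ 3)))
      \<le> exp (- (gap / 2) * n)"
proof -
  obtain C where C: "C > 0" "\<forall>\<^sub>F n in sequentially. real (M n) \<le> C * real n ^ k"
    using assms by (auto elim!: landau_o.bigE)
  define g where "g = gap / 2"
  \<comment> \<open>Chosen so that the polynomial bound becomes K times x^(k+6) / exp x at x = g n,
    which tends to 0.\<close>
  define K where "K = 1440 * (C + 1) * 2 ^ 6 / g ^ (k + 6)"
  have g: "g > 0" using gap_pos by (simp add: g_def)
  have "filterlim (\<lambda>n. g * real n) at_top sequentially"
    by (rule filterlim_tendsto_pos_mult_at_top[OF tendsto_const g filterlim_real_sequentially])
  then have "((\<lambda>n. (g * real n) ^ (k + 6) / exp (g * real n)) \<longlongrightarrow> 0) sequentially"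
    by (rule filterlim_compose[OF tendsto_power_div_exp_0])
  from tendsto_mult_right_zero[OF this, of K]
  have "\<forall>\<^sub>F n in sequentially. K * ((g * real n) ^ (k + 6) / exp (g * real n)) < 1"
    by (rule order_tendstoD) simp
  then have "\<forall>\<^sub>F n in sequentially. 1440 * (C * real n ^ k + 1) * (real n + 1) ^ 6 * exp (- (gap / 2) * n) < 1"
    using eventually_ge_at_top[of 1]
  proof eventually_elim
    case (elim n)
    have "C * real n ^ k + 1 \<le> (C + 1) * real n ^ k"
      using elim(2) by (simp add: algebra_simps one_le_power)
    moreover have "(real n + 1) ^ 6 \<le> (2 * real n) ^ 6"
      using elim(2) by (intro power_mono) auto
    ultimately have "1440 * (C * real n ^ k + 1) * (real n + 1) ^ 6 * exp (- g * n)
        \<le> 1440 * ((C + 1) * real n ^ k) * (2 * real n) ^ 6 * exp (- g * n)"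
      using C(1) by (intro mult_right_mono mult_mono) auto
    also have "\<dots> = 1440 * (C + 1) * 2 ^ 6 * real n ^ (k + 6) / exp (g * real n)"
      by (simp add: power_mult_distrib power_add exp_minus divide_inverse mult_ac)
    also have "\<dots> = K * ((g * real n) ^ (k + 6) / exp (g * real n))"
    proof -
      have "g ^ (k + 6) \<noteq> 0" using g by simp
      then show ?thesis unfolding K_def power_mult_distrib by simp
    qed
    finally show ?case using elim(1) unfolding g_def[symmetric] by linarith
  qed
  with C(2) show ?thesis
  proof eventually_elim
    case (elim n)
    have "20 * (9 / 2 * (real (M n) + 1) * (8 * (real n + 1) ^ 3 * exp (- gap * n)) / (1 / (2 * (real n + 1) ^ 3)))
        = 1440 * (real (M n) + 1) * (real n + 1) ^ 6 * exp (- gap * n)"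
      by (simp add: mult_ac flip: power_add)
    also have "\<dots> \<le> 1440 * (C * real n ^ k + 1) * (real n + 1) ^ 6 * exp (- gap * n)"
      using elim(1) by (intro mult_right_mono mult_left_mono) auto
    also have "\<dots> = (1440 * (C * real n ^ k + 1) * (real n + 1) ^ 6 * exp (- (gap / 2) * n)) * exp (- (gap / 2) * n)"
    proof -
      have "exp (- gap * n) = exp (- (gap / 2) * n) * exp (- (gap / 2) * n)"
        by (simp flip: exp_add)
      then show ?thesis by (simp only: mult.assoc)
    qed
    also have "\<dots> \<le> 1 * exp (- (gap / 2) * n)"
      using elim(2) by (intro mult_right_mono) auto
    finally show ?case by (simp only: mult_1_left)
  qed
qed

theorem mainTheorem2:
  "\<exists>c1::real. c1 > 0 \<and>
     (\<forall>(M :: nat \<Rightarrow> nat) (\<beta> :: nat \<Rightarrow> nat \<Rightarrow> real).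
        (\<exists>k::nat. (\<lambda>n. real (M n)) \<in> O(\<lambda>n. real n ^ k)) \<longrightarrow>
        (\<forall>n\<ge>1. \<beta> n (M n) = beta_crit n \<and>
                (\<forall>i<M n. \<beta> n i \<le> \<beta> n (i + 1)) \<and> 0 \<le> \<beta> n 0) \<longrightarrow>
        (\<forall>\<^sub>F n in sequentially. \<forall>\<epsilon>::real. 0 < \<epsilon> \<and> \<epsilon> \<le> 1 / 2 \<longrightarrow>
           ereal (exp (c1 * real n) * ln (1 / \<epsilon>))
             \<le> ereal_of_enat (tempering_mixing_time n (M n) (\<beta> n) \<epsilon>) \<and>
           ereal (exp (c1 * real n) * ln (1 / \<epsilon>))
             \<le> ereal_of_enat (swapping_mixing_time n (M n) (\<beta> n) \<epsilon>)))"
\<comment> \<open>The constant is fixed before the levels and temperatures; only the threshold for n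
  depends on the growth of M.\<close>
proof (rule exI[of _ "gap / 2"], intro conjI allI impI)
  show "0 < gap / 2" using gap_pos by simp
  fix M :: "nat \<Rightarrow> nat" and \<beta> :: "nat \<Rightarrow> nat \<Rightarrow> real"
  assume "\<exists>k::nat. (\<lambda>n. real (M n)) \<in> O(\<lambda>n. real n ^ k)"
  then obtain k :: nat where "(\<lambda>n. real (M n)) \<in> O(\<lambda>n. real n ^ k)" by blast
  note ev = eventually_conductance_le[OF this]
  assume \<beta>: "\<forall>n\<ge>1. \<beta> n (M n) = beta_crit n \<and> (\<forall>i<M n. \<beta> n i \<le> \<beta> n (i + 1)) \<and> 0 \<le> \<beta> n 0"
  \<comment> \<open>The first condition yields \<delta> \<le> 1/20, the second is what the Chernoff
    bound needs.\<close>
  have "\<forall>\<^sub>F n :: nat in sequentially. exp (- (gap / 2) * n) < 1 \<and> n \<ge> 12"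
    using eventually_ge_at_top[of 12] by eventually_elim (use gap_pos in simp)
  with ev show "\<forall>\<^sub>F n in sequentially. \<forall>\<epsilon>::real. 0 < \<epsilon> \<and> \<epsilon> \<le> 1 / 2 \<longrightarrow>
      ereal (exp (gap / 2 * real n) * ln (1 / \<epsilon>)) \<le> ereal_of_enat (tempering_mixing_time n (M n) (\<beta> n) \<epsilon>) \<and>
      ereal (exp (gap / 2 * real n) * ln (1 / \<epsilon>)) \<le> ereal_of_enat (swapping_mixing_time n (M n) (\<beta> n) \<epsilon>)"
  proof eventually_elim
    case (elim n)
    define b where "b = 8 * (real n + 1) ^ 3 * exp (- gap * n)"
    define p where "p = 1 / (2 * (real n + 1) ^ 3)"
    define \<delta> where "\<delta> = 9 / 2 * (real (M n) + 1) * b / p"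
    have d: "20 * \<delta> \<le> exp (- (gap / 2) * n)" using elim(1) unfolding \<delta>_def b_def p_def .
    have n: "exp (- (gap / 2) * n) < 1" "n \<ge> 12" using elim(2) by auto
    have bp: "0 < b" "0 < p" by (simp_all add: b_def p_def)
    then have d0: "0 < \<delta>" by (simp add: \<delta>_def)
    have \<beta>n: "\<beta> n (M n) = beta_crit n" "\<And>i. i < M n \<Longrightarrow> \<beta> n i \<le> \<beta> n (i + 1)" "0 \<le> \<beta> n 0"
      using \<beta> n by auto
    have mono: "\<beta> n i \<le> \<beta> n j" if "i \<le> j" "j \<le> M n" for i j
      using that
    proof (induction j rule: dec_induct)
      case (step j)
      then show ?case using \<beta>n(2)[of j] by simp
    qed simp
    interpret symmetric_level_distributions n "M n" "\<lambda>i. gibbs n (\<beta> n i)"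
      using n by (intro gibbs_symmetric_level_distributions) simp
    have b: "sum (gibbs n (\<beta> n i)) (boundary n) \<le> b" if "i \<le> M n" for i
      unfolding b_def using mono[of 0 i] mono[of i "M n"] \<beta>n that n by (intro gibbs_boundary_le) auto
    have p: "p \<le> sum (gibbs n (\<beta> n (M n))) (ordered n 1)"
      unfolding p_def \<beta>n(1) using n by (intro gibbs_ordered_ge) simp
    have "exp (gap / 2 * n) * (20 * \<delta>) \<le> exp (gap / 2 * n) * exp (- (gap / 2) * n)"
      using d by (intro mult_left_mono) auto
    also have "\<dots> = 1" by (simp flip: exp_add)
    finally have le: "exp (gap / 2 * n) \<le> 1 / (20 * \<delta>)" using d0 by (simp add: le_divide_eq)
    have d1: "\<delta> \<le> 1 / 20" using d n by linarith
    show ?case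
    proof (intro allI impI)
      fix \<epsilon> :: real
      assume \<epsilon>: "0 < \<epsilon> \<and> \<epsilon> \<le> 1 / 2"
      have "exp (gap / 2 * n) * ln (1 / \<epsilon>) \<le> 1 / (20 * \<delta>) * ln (1 / \<epsilon>)"
        using le \<epsilon> by (intro mult_right_mono) auto
      then have le': "ereal (exp (gap / 2 * n) * ln (1 / \<epsilon>)) \<le> ereal (ln (1 / \<epsilon>) / (20 * \<delta>))"
        by simp
      show "ereal (exp (gap / 2 * real n) * ln (1 / \<epsilon>)) \<le> ereal_of_enat (tempering_mixing_time n (M n) (\<beta> n) \<epsilon>) \<and>
        ereal (exp (gap / 2 * real n) * ln (1 / \<epsilon>)) \<le> ereal_of_enat (swapping_mixing_time n (M n) (\<beta> n) \<epsilon>)"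
        unfolding tempering_mixing_time_def swapping_mixing_time_def
        using order_trans[OF le' tempering_mixing_time_ge[OF b bp(2) p \<delta>_def d0 d1]]
          order_trans[OF le' swapping_mixing_time_ge[OF b bp(2) p \<delta>_def d0 d1]] \<epsilon> by blast
    qed
  qed
qed

end
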